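(* Let $k$ be a field, let $G$ be a finite simple graph without isolated vertices, with nonempty vertex set $V(G)=\{x_1,\dots,x_n\}$ and with $p$ connected components, let $R=k[x_1,\dots,x_n]$, let $I=I(G)\subseteq R$ be the edge ideal of $G$, and let $d=d(G)$ be the diameter of $G$. Then for $1\leq t\leq 3$, $$\operatorname{sdepth} R/I^t\ \geq\ \left\lceil \frac{d-4t+5}{3}\right\rceil+p-1 ,$$ where $\operatorname{sdepth}$ denotes Stanley depth.
   Context: Simple graph: no loops and no multiple edges. Vertices of $G$ are identified with the variables of $R$. The edge ideal $I(G)$ is the ideal of $R$ generated by the monomials $x_ix_j$ with $\{x_i,x_j\}\in E(G)$. The diameter of a connected graph is the maximum of the distances $d(u,v)$ (length of a shortest path) over all pairs of vertices; the diameter of a disconnected graph means the maximum of the diameters of its connected components. Stanley depth: let $M$ be a nonzero finitely generated $\mathbb{Z}^n$-graded $R$-module. For a homogeneous element $u\in M$ and a subset $Z\subset\{x_1,\dots,x_n\}$, $uk[Z]$ denotes the $k$-subspace of $M$ generated by all $uv$ with $v$ a monomial in $k[Z]$. As usual, such a $uk[Z]$ is used in a decomposition only when it is a free $k[Z]$-module (a Stanley space). A presentation of $M$ as a finite direct sum of such $k$-subspaces, $\mathcal D:\ M=\bigoplus_{i=1}^r u_ik[Z_i]$, is called a Stanley decomposition of $M$; put $\operatorname{sdepth}\mathcal D=\min\{|Z_i| : i=1,\dots,r\}$ and $\operatorname{sdepth} M=\max\{\operatorname{sdepth}\mathcal D : \mathcal D \text{ is a Stanley decomposition of } M\}$. 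*)

theory Defs
  imports
    Complex_Main
    "HOL-Library.Poly_Mapping"
    "HOL-Library.FuncSet"
    "HOL-Algebra.Module"
    "HOL-Algebra.QuotRing"
    "HOL-Algebra.Ideal_Product"
begin

section \<open>Simple graphs, components and diameter\<close>

definition simple_graph :: "'v set \<Rightarrow> 'v set set \<Rightarrow> bool" where
  "simple_graph V E \<longleftrightarrow> finite V \<and> (\<forall>e\<in>E. e \<subseteq> V \<and> card e = 2)"

definition no_isolated_vertices :: "'v set \<Rightarrow> 'v set set \<Rightarrow> bool" where
  "no_isolated_vertices V E \<longleftrightarrow> (\<forall>v\<in>V. \<exists>e\<in>E. v \<in> e)"

definition path_between :: "'v set \<Rightarrow> 'v set set \<Rightarrow> 'v \<Rightarrow> 'v list \<Rightarrow> 'v \<Rightarrow> bool" where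
  "path_between V E u xs v \<longleftrightarrow>
     xs \<noteq> [] \<and> hd xs = u \<and> last xs = v \<and> set xs \<subseteq> V \<and> distinct xs \<and>
     successively (\<lambda>x y. {x, y} \<in> E) xs"

text \<open>The length of a path is its number of edges. \<open>graph_dist\<close> is only meaningful for two
  vertices of the same component.\<close>

definition graph_dist :: "'v set \<Rightarrow> 'v set set \<Rightarrow> 'v \<Rightarrow> 'v \<Rightarrow> nat" where
  "graph_dist V E u v = (LEAST l. \<exists>xs. path_between V E u xs v \<and> l = length xs - 1)"

definition components :: "'v set \<Rightarrow> 'v set set \<Rightarrow> 'v set set" where
  "components V E = V // {(u, v). u \<in> V \<and> v \<in> V \<and> (\<exists>xs. path_between V E u xs v)}"

definition component_diameter :: "'v set \<Rightarrow> 'v set set \<Rightarrow> 'v set \<Rightarrow> nat" where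
  "component_diameter V E C = Max {graph_dist V E u v | u v. u \<in> C \<and> v \<in> C}"

definition diameter :: "'v set \<Rightarrow> 'v set set \<Rightarrow> nat" where
  "diameter V E = Max (component_diameter V E ` components V E)"

section \<open>Polynomial rings and edge ideals\<close>

text \<open>A monomial is a finitely supported exponent vector \<open>'v \<Rightarrow>\<^sub>0 nat\<close>; the variables are the
  elements of \<open>'v\<close>, and \<open>mpoly_ring Z\<close> is the subring \<open>k[Z]\<close> of polynomials in the variables
  from \<open>Z\<close>.\<close>

type_synonym ('v, 'k) mpoly = "('v \<Rightarrow>\<^sub>0 nat) \<Rightarrow>\<^sub>0 'k"

definition mpoly_ring :: "'v set \<Rightarrow> ('v, 'k::field) mpoly ring" where
  "mpoly_ring Z =
     \<lparr>carrier = {f. \<forall>m\<in>Poly_Mapping.keys f. Poly_Mapping.keys m \<subseteq> Z},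
      mult = (*), one = 1, zero = 0, add = (+)\<rparr>"

definition monom :: "('v \<Rightarrow>\<^sub>0 nat) \<Rightarrow> ('v, 'k::field) mpoly" where
  "monom m = Poly_Mapping.single m 1"

definition var :: "'v \<Rightarrow> ('v, 'k::field) mpoly" where
  "var x = monom (Poly_Mapping.single x 1)"

definition edge_ideal :: "'v set \<Rightarrow> 'v set set \<Rightarrow> ('v, 'k::field) mpoly set" where
  "edge_ideal V E = Idl\<^bsub>mpoly_ring V\<^esub> {var x * var y | x y. {x, y} \<in> E}"

section \<open>Multigraded modules and Stanley depth\<close>

text \<open>A \<open>\<int>\<^sup>n\<close>-graded module over \<open>k[V]\<close> is given by a module \<open>M\<close> and its graded components
  \<open>gr :: ('v \<Rightarrow> int) \<Rightarrow> 'm set\<close>; degrees are functions on \<open>'v\<close>, and a degree not vanishing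
  outside \<open>V\<close> has zero component.\<close>

text \<open>The \<open>k\<close>-subspace \<open>u k[Z]\<close> generated by all \<open>u v\<close> with \<open>v\<close> a monomial in \<open>k[Z]\<close>. The field
  \<open>k\<close> acts on \<open>M\<close> through the constant polynomials, i.e. through \<open>mpoly_ring {}\<close>.\<close>

definition stanley_space ::
    "(('v, 'k::field) mpoly, 'm) module \<Rightarrow> 'm \<Rightarrow> 'v set \<Rightarrow> 'm set" where
  "stanley_space M u Z =
     (\<lambda>W. submodule W (mpoly_ring {}) M) hull
       {monom m \<odot>\<^bsub>M\<^esub> u | m. Poly_Mapping.keys m \<subseteq> Z}"

text \<open>The cyclic \<open>k[Z]\<close>-module \<open>u k[Z]\<close> is free (and nonzero) iff \<open>{u}\<close> is a basis of it, that is,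
  iff \<open>u\<close> has no annihilator in \<open>k[Z]\<close>.\<close>

definition free_generator ::
    "(('v, 'k::field) mpoly, 'm) module \<Rightarrow> 'm \<Rightarrow> 'v set \<Rightarrow> bool" where
  "free_generator M u Z \<longleftrightarrow>
     (\<forall>f \<in> carrier (mpoly_ring Z). f \<odot>\<^bsub>M\<^esub> u = \<zero>\<^bsub>M\<^esub> \<longrightarrow> f = 0)"

definition direct_sum_decomposition :: "('a, 'm) module \<Rightarrow> 'm set list \<Rightarrow> bool" where
  "direct_sum_decomposition M Ws \<longleftrightarrow>
     (\<forall>W \<in> set Ws. W \<subseteq> carrier M) \<and>
     (\<forall>x \<in> carrier M. \<exists>!w. w \<in> (\<Pi>\<^sub>E i\<in>{..<length Ws}. Ws ! i) \<and>
                          x = (\<Oplus>\<^bsub>M\<^esub>i\<in>{..<length Ws}. w i))"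

definition stanley_decomposition ::
    "'v set \<Rightarrow> (('v, 'k::field) mpoly, 'm) module \<Rightarrow> (('v \<Rightarrow> int) \<Rightarrow> 'm set) \<Rightarrow>
     ('m \<times> 'v set) list \<Rightarrow> bool" where
  "stanley_decomposition V M gr D \<longleftrightarrow>
     (\<forall>(u, Z) \<in> set D. (\<exists>a. u \<in> gr a) \<and> Z \<subseteq> V \<and> free_generator M u Z) \<and>
     direct_sum_decomposition M (map (\<lambda>(u, Z). stanley_space M u Z) D)"

definition sdepth_decomposition :: "('m \<times> 'v set) list \<Rightarrow> nat" where
  "sdepth_decomposition D = Min {card Z | u Z. (u, Z) \<in> set D}"

text \<open>For a nonzero finitely generated multigraded \<open>M\<close> and finite \<open>V\<close> the set below is nonempty
  and bounded by \<open>card V\<close>.\<close>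

definition sdepth ::
    "'v set \<Rightarrow> (('v, 'k::field) mpoly, 'm) module \<Rightarrow> (('v \<Rightarrow> int) \<Rightarrow> 'm set) \<Rightarrow> nat" where
  "sdepth V M gr = Max {sdepth_decomposition D | D. stanley_decomposition V M gr D}"

section \<open>The multigraded module \<open>R/J\<close>\<close>

definition quotient_module :: "'a ring \<Rightarrow> 'a set \<Rightarrow> ('a, 'a set) module" where
  "quotient_module R J =
     \<lparr>carrier = carrier (R Quot J), mult = mult (R Quot J), one = one (R Quot J),
      zero = zero (R Quot J), add = add (R Quot J),
      smult = (\<lambda>r X. (J +>\<^bsub>R\<^esub> r) \<otimes>\<^bsub>R Quot J\<^esub> X)\<rparr>"

definition mpoly_component ::
    "'v set \<Rightarrow> ('v \<Rightarrow> int) \<Rightarrow> ('v, 'k::field) mpoly set" where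
  "mpoly_component V a =
     {f \<in> carrier (mpoly_ring V).
        \<forall>m\<in>Poly_Mapping.keys f. \<forall>v. a v = int (Poly_Mapping.lookup m v)}"

definition quotient_component ::
    "'v set \<Rightarrow> ('v, 'k::field) mpoly set \<Rightarrow> ('v \<Rightarrow> int) \<Rightarrow> ('v, 'k) mpoly set set" where
  "quotient_component V J a = (\<lambda>f. J +>\<^bsub>mpoly_ring V\<^esub> f) ` mpoly_component V a"

definition sdepth_quotient :: "'v set \<Rightarrow> ('v, 'k::field) mpoly set \<Rightarrow> nat" where
  "sdepth_quotient V J =
     sdepth V (quotient_module (mpoly_ring V) J) (quotient_component V J)"

end

theory Submission
  imports Defs "HOL-Library.Multiset"
begin

text \<open>A Stanley decomposition of \<open>R/I\<^sup>t\<close> is a partition of the monomials outside \<open>I\<^sup>t\<close> into cones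
  \<open>c \<cdot> Mon(Z)\<close>. Dividing a monomial by edges as long as possible, in a fixed order, writes it as \<open>w m\<close>
  with \<open>w\<close> a product of fewer than \<open>t\<close> edges and the support of \<open>m\<close> independent; the order only
  forbids variables adjacent to \<open>w\<close>. For \<open>t \<le> 3\<close> the condition \<open>w m \<notin> I\<^sup>t\<close> is either automatic or says
  that \<open>m\<close> is not divisible by \<open>u v\<close> for any \<open>u, v\<close> joined by a walk alternating between edges and the
  factors of \<open>w\<close>. So the monomials \<open>m\<close> are those avoiding the edge ideal of a graph \<open>H\<close> with loops,
  which agrees with the given graph away from \<open>w\<close>.

  If \<open>P\<close> is a set of vertices with pairwise disjoint closed neighbourhoods in a simple graph, then
  the monomials with independent support can be partitioned into cones of dimension at least
  \<open>card P\<close>. Hence it suffices to find a large \<open>P\<close> at distance at least 2 from \<open>w\<close> and from the loop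
  vertices of \<open>H\<close> dividing \<open>m\<close>. Each factor of \<open>w\<close>, together with the loops it produces, excludes at
  most four vertices of a geodesic of length \<open>d\<close> or all of one other component. Taking every third
  remaining vertex of the geodesic and one vertex in each remaining component gives \<open>P\<close>.\<close>

section \<open>Partitions of sets of monomials into cones\<close>

text \<open>The bound is a count along a geodesic with \<open>d + 1\<close> vertices. The closed
  neighbourhood of an edge has diameter at most 3, so it meets the geodesic in at most 4 vertices;
  \<open>t - 1\<close> edges leave at least \<open>d + 1 - 4 * (t - 1) = d - 4 * t + 5\<close>
  vertices, and every third one is kept. An edge in another component costs that component's single
  point, which is worth 3 vertices in this count, hence less than 4. The obstacle is the loops. A
  loop vertex dividing the monomial excludes its own neighbourhood as well, which could cost more
  than 4 vertices per factor. For at most two factors it does not: the loop vertices either complete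
  a factor to a triangle, which is no wider than an edge, or lie on a closed walk of length 5
  through both factors, whose neighbourhood meets the geodesic in at most 8 vertices. This is one
  use of \<open>t \<le> 3\<close>. The other is that fewer than \<open>t - 1\<close> factors have
  fewer than \<open>t\<close> variables in all, while each of \<open>t\<close> edges dividing
  \<open>w m\<close> would have to use one of them.\<close>

definition cone :: "'v multiset \<Rightarrow> 'v set \<Rightarrow> 'v multiset set" where
  "cone c Z = {c + m | m. set_mset m \<subseteq> Z}"

text \<open>In the combinatorial part monomials are multisets of variables: sum is product,
  \<open>\<subseteq>#\<close> is divisibility, \<open>set_mset\<close> is the support. The inductive
  form makes unions, shifts and free variables plain rule inductions;
  \<open>cone_partition_list\<close> recovers the family of cones. The empty set has a partition for
  every \<open>b\<close>, so classes that turn out empty cost nothing.\<close>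

inductive cone_partition :: "'v set \<Rightarrow> nat \<Rightarrow> 'v multiset set \<Rightarrow> bool" for V b where
  empty: "cone_partition V b {}"
| add: "cone_partition V b S \<Longrightarrow> set_mset c \<subseteq> V \<Longrightarrow> Z \<subseteq> V \<Longrightarrow> b \<le> card Z \<Longrightarrow> cone c Z \<inter> S = {} \<Longrightarrow>
    cone_partition V b (cone c Z \<union> S)"

lemma cone_partition_cone:
  "set_mset c \<subseteq> V \<Longrightarrow> Z \<subseteq> V \<Longrightarrow> b \<le> card Z \<Longrightarrow> cone_partition V b (cone c Z)"
  using cone_partition.add[OF cone_partition.empty, of c V Z b] by simp

lemma cone_partition_Un:
  assumes "cone_partition V b S" "cone_partition V b T" "S \<inter> T = {}"
  shows "cone_partition V b (S \<union> T)"
  using assms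
proof (induction rule: cone_partition.induct)
  case (add S c Z)
  then show ?case
    using cone_partition.add[of V b "S \<union> T" c Z] by (auto simp: Un_assoc Int_Un_distrib)
qed simp

lemma cone_partition_UN:
  assumes "finite I" "\<And>i. i \<in> I \<Longrightarrow> cone_partition V b (S i)"
    and "\<And>i j. i \<in> I \<Longrightarrow> j \<in> I \<Longrightarrow> i \<noteq> j \<Longrightarrow> S i \<inter> S j = {}"
  shows "cone_partition V b (\<Union>i\<in>I. S i)"
  using assms
proof (induction I rule: finite_induct)
  case (insert x F)
  have "S x \<inter> (\<Union>i\<in>F. S i) = {}"
    using insert.prems(2)[of x] insert.hyps(2) by fastforce
  then show ?case
    using cone_partition_Un[of V b "S x" "\<Union>i\<in>F. S i"] insert by auto
qed (simp add: cone_partition.empty)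

lemma cone_shift: "(+) d ` cone c Z = cone (d + c) Z"
  by (auto simp: cone_def image_iff add.assoc)

lemma cone_partition_shift:
  assumes "cone_partition V b S" "set_mset d \<subseteq> V"
  shows "cone_partition V b ((+) d ` S)"
  using assms
proof (induction rule: cone_partition.induct)
  case (add S c Z)
  have "cone (d + c) Z \<inter> (+) d ` S = {}"
    using add.hyps(5) by (auto simp flip: cone_shift)
  then have "cone_partition V b (cone (d + c) Z \<union> (+) d ` S)"
    using add by (intro cone_partition.add) auto
  then show ?case
    by (simp add: image_Un cone_shift)
qed (simp add: cone_partition.empty)

lemma split_mset_unique:
  assumes "a + x = b + y" "set_mset a \<subseteq> U" "set_mset b \<subseteq> U"
    "set_mset x \<subseteq> Z" "set_mset y \<subseteq> Z" "U \<inter> Z = {}"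
  shows "a = b \<and> x = y"
proof -
  have "count a v = count b v \<and> count x v = count y v" for v
  proof -
    have "count a v + count x v = count b v + count y v"
      using assms(1) by (metis count_union)
    moreover have "v \<notin># a \<and> v \<notin># b \<or> v \<notin># x \<and> v \<notin># y"
      using assms(2-6) by blast
    ultimately show ?thesis
      using assms(2-6) by (metis add_cancel_left_left add_cancel_left_right count_eq_zero_iff disjoint_iff subsetD)
  qed
  then show ?thesis
    by (simp add: multiset_eq_iff)
qed

text \<open>This is where dimension comes from: every cone gains the direction \<open>z\<close>. The
  direction is new, since \<open>z \<in> Z\<close> would put \<open>c + {#z#}\<close>, a multiple of
  \<open>z\<close>, into \<open>S\<close>.\<close>

lemma cone_partition_free_variable:
  assumes "cone_partition V b S" "z \<in> V" "finite V" "\<And>m. m \<in> S \<Longrightarrow> z \<notin># m"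
  shows "cone_partition V (Suc b) {m + replicate_mset n z | m n. m \<in> S}"
  using assms
proof (induction rule: cone_partition.induct)
  case (add S c Z)
  let ?f = "\<lambda>S. {m + replicate_mset n z | m n. m \<in> S}"
  have zc: "z \<notin># c"
    using add.prems(3)[of c] by (force simp: cone_def)
  have zZ: "z \<notin> Z"
  proof
    assume "z \<in> Z"
    then have "c + {#z#} \<in> cone c Z"
      unfolding cone_def by force
    then show False
      using add.prems(3)[of "c + {#z#}"] by auto
  qed
  have eq: "?f (cone c Z) = cone c (insert z Z)"
  proof (intro equalityI subsetI)
    fix x assume "x \<in> cone c (insert z Z)"
    then obtain m where m: "x = c + m" "set_mset m \<subseteq> insert z Z"
      by (auto simp: cone_def)
    have "m = filter_mset (\<lambda>y. y \<noteq> z) m + replicate_mset (count m z) z"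
      by (simp add: multiset_eq_iff)
    then have "x = (c + filter_mset (\<lambda>y. y \<noteq> z) m) + replicate_mset (count m z) z"
      using m(1) by (metis union_assoc)
    moreover have "c + filter_mset (\<lambda>y. y \<noteq> z) m \<in> cone c Z"
      using m(2) unfolding cone_def by auto
    ultimately show "x \<in> ?f (cone c Z)"
      by blast
  next
    fix x assume "x \<in> ?f (cone c Z)"
    then obtain m n where m: "x = c + m + replicate_mset n z" "set_mset m \<subseteq> Z"
      by (auto simp: cone_def)
    then have "x = c + (m + replicate_mset n z)" "set_mset (m + replicate_mset n z) \<subseteq> insert z Z"
      by (auto simp: add.assoc split: if_splits)
    then show "x \<in> cone c (insert z Z)"
      unfolding cone_def by blast
  qed
  have "?f (cone c Z) \<inter> ?f S = {}"
  proof -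
    have False if "m + replicate_mset n z = m' + replicate_mset n' z" "m \<in> cone c Z" "m' \<in> S" for m n m' n'
    proof -
      have "z \<notin># m" "z \<notin># m'"
        using that add.prems(3) by auto
      then have "m = m'"
        using split_mset_unique[OF that(1), of "- {z}" "{z}"] by (auto split: if_splits)
      then show False
        using that add.hyps(5) by blast
    qed
    then show ?thesis
      by blast
  qed
  moreover have "cone_partition V (Suc b) (?f S)"
    using add by blast
  moreover have "Suc b \<le> card (insert z Z)"
    using zZ add.hyps(3,4) \<open>finite V\<close> by (simp add: finite_subset)
  ultimately have "cone_partition V (Suc b) (cone c (insert z Z) \<union> ?f S)"
    using add eq by (intro cone_partition.add) auto
  moreover have "?f (cone c Z \<union> S) = ?f (cone c Z) \<union> ?f S"
    by blast
  ultimately show ?case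
    using eq by simp
qed (simp add: cone_partition.empty)

lemma cone_partition_mono:
  "cone_partition V b S \<Longrightarrow> b' \<le> b \<Longrightarrow> cone_partition V b' S"
  by (induction rule: cone_partition.induct) (auto intro: cone_partition.intros)

lemma cone_partition_list:
  assumes "cone_partition V b S"
  shows "\<exists>D. (\<forall>p \<in> set D. set_mset (fst p) \<subseteq> V \<and> snd p \<subseteq> V \<and> b \<le> card (snd p)) \<and> distinct D \<and>
    pairwise (\<lambda>p q. disjnt (cone (fst p) (snd p)) (cone (fst q) (snd q))) (set D) \<and>
    (\<Union>p\<in>set D. cone (fst p) (snd p)) = S"
  using assms
proof (induction rule: cone_partition.induct)
  case empty
  show ?case by (rule exI[of _ "[]"]) simp
next
  case (add S c Z)
  from add.IH obtain D where D: "\<forall>p \<in> set D. set_mset (fst p) \<subseteq> V \<and> snd p \<subseteq> V \<and> b \<le> card (snd p)"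
    "distinct D" "pairwise (\<lambda>p q. disjnt (cone (fst p) (snd p)) (cone (fst q) (snd q))) (set D)"
    "(\<Union>p\<in>set D. cone (fst p) (snd p)) = S"
    by auto
  have *: "disjnt (cone c Z) (cone (fst p) (snd p))" if "p \<in> set D" for p
    using that add.hyps(5) D(4) unfolding disjnt_def by blast
  \<comment> \<open>A cone is nonempty, so disjointness from the earlier cones also makes the new
    pair different from theirs.\<close>
  have "c \<in> cone c Z"
    unfolding cone_def by force
  then have "(c, Z) \<notin> set D"
    using *[of "(c, Z)"] by (auto simp: disjnt_def)
  then show ?case
    using D add.hyps * by (intro exI[of _ "(c, Z) # D"]) (auto simp: pairwise_insert disjnt_sym)
qed

text \<open>Induction on \<open>U\<close>: if \<open>p \<in> P\<close> has a neighbour \<open>y\<close> in \<open>U\<close>, split according to whether \<open>y\<close> divides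
  the monomial. If it does, \<open>y\<close> is a free variable and replaces \<open>p\<close>, since deleting the neighbours of
  \<open>y\<close> destroys no other element of \<open>P\<close>.\<close>

lemma independent_cone_partition:
  fixes H :: "'v \<Rightarrow> 'v \<Rightarrow> bool"
  assumes "finite U" "U \<subseteq> V" "finite V"
    and sym: "\<And>x y. H x y \<Longrightarrow> H y x" and irr: "\<And>x. x \<in> U \<Longrightarrow> \<not> H x x"
    and "P \<subseteq> U"
    and "\<And>p q. p \<in> P \<Longrightarrow> q \<in> P \<Longrightarrow> \<not> H p q"
    and "\<And>p q z. p \<in> P \<Longrightarrow> q \<in> P \<Longrightarrow> p \<noteq> q \<Longrightarrow> z \<in> U \<Longrightarrow> H p z \<Longrightarrow> \<not> H q z"
  shows "cone_partition V (card P) {m. set_mset m \<subseteq> U \<and> (\<forall>u\<in>#m. \<forall>v\<in>#m. \<not> H u v)}"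
  using assms(1,2) irr assms(6-8)
proof (induction "card U" arbitrary: U P rule: less_induct)
  case less
  show ?case
  proof (cases "P = {}")
    case True
    \<comment> \<open>No dimension is demanded, so one cone for each independent support
      \<open>C\<close> is enough: the product of \<open>C\<close> times all monomials in
      \<open>C\<close>.\<close>
    let ?S = "\<lambda>C. cone (mset_set C) C"
    let ?I = "{C. C \<subseteq> U \<and> (\<forall>u\<in>C. \<forall>v\<in>C. \<not> H u v)}"
    have supp: "set_mset m = C" if "m \<in> ?S C" "C \<subseteq> U" for m C
      using that less.prems(1) by (auto simp: cone_def finite_subset)
    have "{m. set_mset m \<subseteq> U \<and> (\<forall>u\<in>#m. \<forall>v\<in>#m. \<not> H u v)} = (\<Union>C\<in>?I. ?S C)"
    proof (intro equalityI subsetI)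
      fix m assume m: "m \<in> {m. set_mset m \<subseteq> U \<and> (\<forall>u\<in>#m. \<forall>v\<in>#m. \<not> H u v)}"
      have "m = mset_set (set_mset m) + (m - mset_set (set_mset m))"
        by (simp add: mset_set_set_mset_msubset)
      moreover have "set_mset (m - mset_set (set_mset m)) \<subseteq> set_mset m"
        by (meson in_diffD subsetI)
      ultimately have "m \<in> ?S (set_mset m)"
        unfolding cone_def by blast
      then show "m \<in> (\<Union>C\<in>?I. ?S C)"
        using m by blast
    next
      fix m assume "m \<in> (\<Union>C\<in>?I. ?S C)"
      then show "m \<in> {m. set_mset m \<subseteq> U \<and> (\<forall>u\<in>#m. \<forall>v\<in>#m. \<not> H u v)}"
        using supp by fastforce
    qed
    moreover have "cone_partition V 0 (\<Union>C\<in>?I. ?S C)"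
    proof (rule cone_partition_UN)
      show "finite ?I"
        using less.prems(1) by (simp add: finite_subset)
      show "cone_partition V 0 (?S C)" if "C \<in> ?I" for C
      proof (rule cone_partition_cone)
        show "C \<subseteq> V"
          using that less.prems(2) by blast
        then show "set_mset (mset_set C) \<subseteq> V"
          using assms(3) by (simp add: finite_subset)
      qed simp
      show "?S C \<inter> ?S C' = {}" if "C \<in> ?I" "C' \<in> ?I" "C \<noteq> C'" for C C'
      proof -
        have False if "m \<in> ?S C" "m \<in> ?S C'" for m
          using supp[OF that(1)] supp[OF that(2)] \<open>C \<in> ?I\<close> \<open>C' \<in> ?I\<close> \<open>C \<noteq> C'\<close> by simp
        then show ?thesis
          by blast
      qed
    qed
    ultimately show ?thesis
      using True by simp
  next
    case False
    then obtain v where v: "v \<in> P"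
      by blast
    have "finite P"
      using less.prems(1,4) finite_subset by blast
    then have cP: "Suc (card (P - {v})) = card P"
      using v by (simp only: card_Suc_Diff1)
    show ?thesis
    proof (cases "\<exists>y\<in>U. H v y")
      case True
      then obtain y where y: "y \<in> U" "H v y"
        by blast
      have yP: "y \<notin> P"
        using less.prems(5) v y(2) by blast
      let ?U = "U - {y}" and ?U' = "U - {y} - {z. H y z}"
      have 1: "cone_partition V (card P) {m. set_mset m \<subseteq> ?U \<and> (\<forall>u\<in>#m. \<forall>v\<in>#m. \<not> H u v)}"
      proof (rule less.hyps)
        show "card ?U < card U"
          using y(1) less.prems(1) by (intro card_Diff1_less)
        show "\<not> H q z" if "p \<in> P" "q \<in> P" "p \<noteq> q" "z \<in> ?U" "H p z" for p q z
          using that less.prems(6)[of p q z] by blast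
      qed (use less.prems(1-5) yP in auto)
      have "cone_partition V (card (P - {v})) {m. set_mset m \<subseteq> ?U' \<and> (\<forall>u\<in>#m. \<forall>v\<in>#m. \<not> H u v)}"
      proof (rule less.hyps)
        show "card ?U' < card U"
          using y(1) less.prems(1) by (intro psubset_card_mono) auto
        show "P - {v} \<subseteq> ?U'"
        proof
          fix p assume p: "p \<in> P - {v}"
          then have "\<not> H p y"
            using less.prems(6)[of v p y] v y by blast
          then show "p \<in> ?U'"
            using p yP less.prems(4) sym[of y p] by blast
        qed
        show "\<not> H p q" if "p \<in> P - {v}" "q \<in> P - {v}" for p q
          using that less.prems(5) by blast
        show "\<not> H q z" if "p \<in> P - {v}" "q \<in> P - {v}" "p \<noteq> q" "z \<in> ?U'" "H p z" for p q z
          using that less.prems(6)[of p q z] by blast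
        show "\<not> H x x" if "x \<in> ?U'" for x
          using that less.prems(3) by blast
      qed (use less.prems(1,2) in auto)
      then have "cone_partition V (Suc (card (P - {v})))
          {m + replicate_mset n y |m n. m \<in> {m. set_mset m \<subseteq> ?U' \<and> (\<forall>u\<in>#m. \<forall>v\<in>#m. \<not> H u v)}}"
        using y(1) less.prems(2) assms(3) by (intro cone_partition_free_variable) auto
      then have 2: "cone_partition V (card P) ((+) {#y#} `
          {m + replicate_mset n y |m n. m \<in> {m. set_mset m \<subseteq> ?U' \<and> (\<forall>u\<in>#m. \<forall>v\<in>#m. \<not> H u v)}})"
        (is "cone_partition _ _ ?B")
        unfolding cP using y(1) less.prems(2) by (intro cone_partition_shift) auto
      have "{m. set_mset m \<subseteq> U \<and> (\<forall>u\<in>#m. \<forall>v\<in>#m. \<not> H u v)} =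
        {m. set_mset m \<subseteq> ?U \<and> (\<forall>u\<in>#m. \<forall>v\<in>#m. \<not> H u v)} \<union> ?B"
      proof (intro equalityI subsetI)
        fix m assume m: "m \<in> {m. set_mset m \<subseteq> U \<and> (\<forall>u\<in>#m. \<forall>v\<in>#m. \<not> H u v)}"
        show "m \<in> {m. set_mset m \<subseteq> ?U \<and> (\<forall>u\<in>#m. \<forall>v\<in>#m. \<not> H u v)} \<union> ?B"
        proof (cases "y \<in># m")
          case True
          then obtain k where k: "count m y = Suc k"
            by (metis count_greater_zero_iff gr0_implies_Suc)
          let ?m = "filter_mset (\<lambda>z. z \<noteq> y) m"
          have "m = {#y#} + (?m + replicate_mset k y)"
            using k by (simp add: multiset_eq_iff)
          moreover have "set_mset ?m \<subseteq> ?U' \<and> (\<forall>u\<in>#?m. \<forall>v\<in>#?m. \<not> H u v)"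
            using m True by auto
          ultimately show ?thesis
            by blast
        next
          case False
          then show ?thesis
            using m by auto
        qed
      next
        fix m assume "m \<in> {m. set_mset m \<subseteq> ?U \<and> (\<forall>u\<in>#m. \<forall>v\<in>#m. \<not> H u v)} \<union> ?B"
        then show "m \<in> {m. set_mset m \<subseteq> U \<and> (\<forall>u\<in>#m. \<forall>v\<in>#m. \<not> H u v)}"
        proof
          assume "m \<in> ?B"
          then obtain m' n where m': "m = {#y#} + (m' + replicate_mset n y)" "set_mset m' \<subseteq> ?U'"
            "\<forall>u\<in>#m'. \<forall>v\<in>#m'. \<not> H u v"
            by blast
          have m: "set_mset m = insert y (set_mset m')"
            using m'(1) by (auto split: if_splits)
          have "\<not> H y u \<and> \<not> H u y" if "u \<in># m'" for u
            using that m'(2) sym by blast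
          then show ?thesis
            unfolding mem_Collect_eq m using m'(2,3) y(1) less.prems(3) by auto
        qed auto
      qed
      moreover have "{m. set_mset m \<subseteq> ?U \<and> (\<forall>u\<in>#m. \<forall>v\<in>#m. \<not> H u v)} \<inter> ?B = {}"
      proof -
        have "y \<in># m" if "m \<in> ?B" for m
          using that by auto
        then show ?thesis
          by blast
      qed
      ultimately show ?thesis
        using cone_partition_Un[OF 1 2] by (simp only:)
    next
      case no_nbr: False
      \<comment> \<open>A vertex with neither neighbours in \<open>U\<close> nor a loop is
        unconstrained, so \<open>v\<close> itself is the free variable.\<close>
      have vU: "v \<in> U"
        using v less.prems(4) by blast
      let ?U = "U - {v}"
      have "cone_partition V (card (P - {v})) {m. set_mset m \<subseteq> ?U \<and> (\<forall>u\<in>#m. \<forall>v\<in>#m. \<not> H u v)}"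
      proof (rule less.hyps)
        show "card ?U < card U"
          using vU less.prems(1) by (intro card_Diff1_less)
        show "\<not> H p q" if "p \<in> P - {v}" "q \<in> P - {v}" for p q
          using that less.prems(5) by blast
        show "\<not> H q z" if "p \<in> P - {v}" "q \<in> P - {v}" "p \<noteq> q" "z \<in> ?U" "H p z" for p q z
          using that less.prems(6)[of p q z] by blast
      qed (use less.prems(1-4) in auto)
      then have "cone_partition V (Suc (card (P - {v})))
          {m + replicate_mset n v |m n. m \<in> {m. set_mset m \<subseteq> ?U \<and> (\<forall>u\<in>#m. \<forall>v\<in>#m. \<not> H u v)}}"
        using vU less.prems(2) assms(3) by (intro cone_partition_free_variable) auto
      moreover have "{m + replicate_mset n v |m n. m \<in> {m. set_mset m \<subseteq> ?U \<and> (\<forall>u\<in>#m. \<forall>v\<in>#m. \<not> H u v)}}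
        = {m. set_mset m \<subseteq> U \<and> (\<forall>u\<in>#m. \<forall>v\<in>#m. \<not> H u v)}"
      proof (intro equalityI subsetI)
        fix m assume m: "m \<in> {m. set_mset m \<subseteq> U \<and> (\<forall>u\<in>#m. \<forall>v\<in>#m. \<not> H u v)}"
        let ?m = "filter_mset (\<lambda>z. z \<noteq> v) m"
        have "m = ?m + replicate_mset (count m v) v"
          by (simp add: multiset_eq_iff)
        moreover have "set_mset ?m \<subseteq> ?U \<and> (\<forall>u\<in>#?m. \<forall>v\<in>#?m. \<not> H u v)"
          using m by auto
        ultimately show "m \<in> {m + replicate_mset n v |m n. m \<in> {m. set_mset m \<subseteq> ?U \<and> (\<forall>u\<in>#m. \<forall>v\<in>#m. \<not> H u v)}}"
          by blast
      next
        fix m assume "m \<in> {m + replicate_mset n v |m n. m \<in> {m. set_mset m \<subseteq> ?U \<and> (\<forall>u\<in>#m. \<forall>v\<in>#m. \<not> H u v)}}"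
        then obtain m' n where m': "m = m' + replicate_mset n v" "set_mset m' \<subseteq> ?U"
          "\<forall>u\<in>#m'. \<forall>v\<in>#m'. \<not> H u v"
          by blast
        have m: "set_mset m \<subseteq> insert v (set_mset m')"
          using m'(1) by (auto split: if_splits)
        have "\<not> H v u \<and> \<not> H u v" if "u \<in># m'" for u
          using that m'(2) no_nbr sym by blast
        then have "\<forall>x\<in>insert v (set_mset m'). \<forall>y\<in>insert v (set_mset m'). \<not> H x y"
          using m'(3) vU less.prems(3) by auto
        then show "m \<in> {m. set_mset m \<subseteq> U \<and> (\<forall>u\<in>#m. \<forall>v\<in>#m. \<not> H u v)}"
          using m m'(2) vU by blast
      qed
      ultimately show ?thesis
        unfolding cP by simp
    qed
  qed
qed

section \<open>Products of edges and alternating walks\<close>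

text \<open>For \<open>u = v\<close> this is divisibility by a square, so a single condition on
  pairs expresses edges and loops alike.\<close>

lemma pair_subseteq_mset_iff:
  "{#u, v#} \<subseteq># m \<longleftrightarrow> u \<in># m \<and> v \<in># m \<and> (u = v \<longrightarrow> 2 \<le> count m u)"
proof (cases "u = v")
  case True
  have "{#u, u#} \<subseteq># m \<longleftrightarrow> 2 \<le> count m u"
    using count_le_replicate_mset_subset_eq[of 2 m u] by (simp add: numeral_2_eq_2)
  moreover have "2 \<le> count m u \<Longrightarrow> u \<in># m"
    by (metis count_eq_zero_iff not_numeral_le_zero)
  ultimately show ?thesis
    using True by auto
next
  case False
  then show ?thesis
    by (simp add: insert_subset_eq_iff in_diff_count)
qed

text \<open>A loop at \<open>u\<close> means that \<open>u\<^sup>2\<close> is forbidden, so \<open>u\<close> can occur but is never a free variable. The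
  set \<open>C\<close> of loop vertices dividing a monomial is therefore fixed first, and \<open>P\<close> may depend on it.\<close>

lemma loop_graph_cone_partition:
  fixes H :: "'v \<Rightarrow> 'v \<Rightarrow> bool"
  assumes "U \<subseteq> V" "finite V"
    and sym: "\<And>x y. H x y \<Longrightarrow> H y x"
    and ex: "\<And>C. C \<subseteq> U \<Longrightarrow> (\<And>c. c \<in> C \<Longrightarrow> H c c) \<Longrightarrow>
        (\<And>c c'. c \<in> C \<Longrightarrow> c' \<in> C \<Longrightarrow> c \<noteq> c' \<Longrightarrow> \<not> H c c') \<Longrightarrow>
      \<exists>P. b \<le> card P \<and> P \<subseteq> U \<and> (\<forall>p\<in>P. \<forall>c\<in>C. \<not> H p c) \<and> (\<forall>p\<in>P. \<forall>q\<in>P. \<not> H p q) \<and>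
        (\<forall>p\<in>P. \<forall>q\<in>P. p \<noteq> q \<longrightarrow> (\<forall>z\<in>U. H p z \<longrightarrow> \<not> H q z))"
  shows "cone_partition V b {m. set_mset m \<subseteq> U \<and> (\<forall>u v. {#u, v#} \<subseteq># m \<longrightarrow> \<not> H u v)}"
proof -
  \<comment> \<open>Each \<open>C \<in> I\<close> stands for the exact set of loop vertices dividing
    a monomial; they occur to the first power only. \<open>W C\<close> are the loopless vertices
    still allowed next to \<open>C\<close>, and \<open>T C\<close> are the cofactors of the product
    of \<open>C\<close>.\<close>
  define L where "L = {x \<in> U. H x x}"
  define W where "W = (\<lambda>C. U - L - {z. \<exists>c\<in>C. H c z})"
  define T where "T = (\<lambda>C. {m. set_mset m \<subseteq> W C \<and> (\<forall>u\<in>#m. \<forall>v\<in>#m. \<not> H u v)})"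
  define I where "I = {C. C \<subseteq> L \<and> (\<forall>u\<in>C. \<forall>v\<in>C. u \<noteq> v \<longrightarrow> \<not> H u v)}"
  have finU: "finite U"
    using assms(1,2) finite_subset by blast
  have finC: "finite C" "C \<subseteq> L" if "C \<in> I" for C
    using that finU unfolding I_def L_def by (auto intro: finite_subset)
  have part: "cone_partition V b ((+) (mset_set C) ` T C)" if CI: "C \<in> I" for C
  proof -
    obtain P where P: "b \<le> card P" "P \<subseteq> U" "\<forall>p\<in>P. \<forall>c\<in>C. \<not> H p c" "\<forall>p\<in>P. \<forall>q\<in>P. \<not> H p q"
      "\<forall>p\<in>P. \<forall>q\<in>P. p \<noteq> q \<longrightarrow> (\<forall>z\<in>U. H p z \<longrightarrow> \<not> H q z)"
    proof -
      have "C \<subseteq> U" "\<And>c. c \<in> C \<Longrightarrow> H c c" "\<And>c c'. c \<in> C \<Longrightarrow> c' \<in> C \<Longrightarrow> c \<noteq> c' \<Longrightarrow> \<not> H c c'"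
        using CI unfolding I_def L_def by auto
      then show thesis
        using ex[of C] that by auto
    qed
    have "cone_partition V (card P) (T C)"
      unfolding T_def
    proof (rule independent_cone_partition)
      show "P \<subseteq> W C"
        using P(2-4) sym unfolding W_def L_def by blast
      show "\<not> H q z" if "p \<in> P" "q \<in> P" "p \<noteq> q" "z \<in> W C" "H p z" for p q z
        using that P(5) unfolding W_def by blast
      show "\<not> H x x" if "x \<in> W C" for x
        using that unfolding W_def L_def by blast
    qed (use assms(1,2) finU sym P(4) in \<open>auto simp: W_def\<close>)
    then have "cone_partition V b (T C)"
      using P(1) cone_partition_mono by blast
    moreover have "set_mset (mset_set C) \<subseteq> V"
      using finC[OF CI] assms(1) by (auto simp: L_def)
    ultimately show ?thesis
      by (rule cone_partition_shift)
  qed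
  \<comment> \<open>\<open>C\<close> can be read off from the monomial, so different
    \<open>C\<close> give disjoint classes.\<close>
  have supp: "set_mset m \<inter> L = C" if "m \<in> (+) (mset_set C) ` T C" "C \<in> I" for m C
    using that finC[OF that(2)] by (auto simp: T_def W_def)
  have "cone_partition V b (\<Union>C\<in>I. (+) (mset_set C) ` T C)"
  proof (rule cone_partition_UN)
    show "finite I"
      using finU unfolding I_def L_def by (auto intro: finite_subset[of _ "Pow U"])
    show "(+) (mset_set C) ` T C \<inter> (+) (mset_set C') ` T C' = {}"
      if "C \<in> I" "C' \<in> I" "C \<noteq> C'" for C C'
    proof -
      have False if "m \<in> (+) (mset_set C) ` T C" "m \<in> (+) (mset_set C') ` T C'" for m
        using supp[OF that(1) \<open>C \<in> I\<close>] supp[OF that(2) \<open>C' \<in> I\<close>] \<open>C \<noteq> C'\<close> by simp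
      then show ?thesis
        by blast
    qed
  qed (rule part)
  moreover have "(\<Union>C\<in>I. (+) (mset_set C) ` T C) =
      {m. set_mset m \<subseteq> U \<and> (\<forall>u v. {#u, v#} \<subseteq># m \<longrightarrow> \<not> H u v)}"
  proof (intro equalityI subsetI)
    fix m assume "m \<in> (\<Union>C\<in>I. (+) (mset_set C) ` T C)"
    then obtain C m' where C: "C \<in> I" "m = mset_set C + m'" "m' \<in> T C"
      by blast
    have m': "set_mset m' \<subseteq> W C" "\<And>u v. u \<in># m' \<Longrightarrow> v \<in># m' \<Longrightarrow> \<not> H u v"
      using C(3) unfolding T_def by auto
    have m: "set_mset m = C \<union> set_mset m'"
      using C(2) finC[OF C(1)] by simp
    have "\<not> H u v" if "{#u, v#} \<subseteq># m" for u v
    proof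
      assume H: "H u v"
      have uv: "u \<in> C \<or> u \<in># m'" "v \<in> C \<or> v \<in># m'"
        using that m unfolding pair_subseteq_mset_iff by blast+
      have "u \<in> C \<and> v \<in> C"
        using uv m' H sym unfolding W_def by blast
      moreover from this have "u = v"
        using C(1) H unfolding I_def by blast
      ultimately have "2 \<le> count m u" "u \<in> C"
        using that unfolding pair_subseteq_mset_iff by auto
      moreover have "count (mset_set C) u = 1"
        using \<open>u \<in> C\<close> finC[OF C(1)] by simp
      moreover have "u \<notin># m'"
        using m'(1) finC[OF C(1)] \<open>u \<in> C\<close> unfolding W_def by blast
      ultimately show False
        using C(2) by (simp add: not_in_iff)
    qed
    moreover have "set_mset m \<subseteq> U"
      using m m'(1) finC[OF C(1)] unfolding W_def L_def by blast
    ultimately show "m \<in> {m. set_mset m \<subseteq> U \<and> (\<forall>u v. {#u, v#} \<subseteq># m \<longrightarrow> \<not> H u v)}"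
      by blast
  next
    fix m assume m: "m \<in> {m. set_mset m \<subseteq> U \<and> (\<forall>u v. {#u, v#} \<subseteq># m \<longrightarrow> \<not> H u v)}"
    have indep: "\<not> H u v" if "u \<in># m" "v \<in># m" "u \<noteq> v" for u v
      using m that by (simp add: pair_subseteq_mset_iff)
    have loop: "count m u = 1" if "u \<in># m" "u \<in> L" for u
    proof -
      have "\<not> 2 \<le> count m u"
        using m that unfolding L_def by (auto simp: pair_subseteq_mset_iff)
      then show ?thesis
        using that(1) by (metis One_nat_def Suc_1 Suc_leI count_greater_zero_iff le_neq_implies_less not_less_eq_eq)
    qed
    let ?C = "set_mset m \<inter> L" and ?m = "filter_mset (\<lambda>x. x \<notin> L) m"
    have C: "?C \<in> I"
      using indep unfolding I_def by blast
    have "count m x = count (mset_set ?C + ?m) x" for x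
    proof (cases "x \<in># m")
      case True
      then show ?thesis
        using loop[of x] by (simp add: count_mset_set')
    qed (simp add: not_in_iff)
    then have "m = mset_set ?C + ?m"
      by (simp add: multiset_eq_iff)
    moreover have "?m \<in> T ?C"
    proof -
      have "set_mset ?m \<subseteq> W ?C"
        using m indep unfolding W_def by auto
      moreover have "\<not> H u v" if "u \<in># ?m" "v \<in># ?m" for u v
        using that indep[of u v] m unfolding L_def by auto
      ultimately show ?thesis
        unfolding T_def by blast
    qed
    ultimately show "m \<in> (\<Union>C\<in>I. (+) (mset_set C) ` T C)"
      using C by blast
  qed
  ultimately show ?thesis
    by simp
qed

text \<open>Walks from \<open>u\<close> to \<open>v\<close> that alternate between arbitrary edges and edges consumed from the
  multiset \<open>W\<close>, starting and ending with an arbitrary edge: \<open>u\<close> and \<open>v\<close> are even-connected with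
  respect to \<open>W\<close>.\<close>

inductive alt_walk :: "'v set set \<Rightarrow> 'v set multiset \<Rightarrow> 'v \<Rightarrow> 'v \<Rightarrow> bool" for E where
  edge: "{u, v} \<in> E \<Longrightarrow> alt_walk E W u v"
| step: "{u, a} \<in> E \<Longrightarrow> alt_walk E W b v \<Longrightarrow> alt_walk E (add_mset {a, b} W) u v"

lemma alt_walk_mono: "alt_walk E W u v \<Longrightarrow> alt_walk E (W + W') u v"
  by (induction rule: alt_walk.induct) (auto intro: alt_walk.intros)

text \<open>The rules prolong a walk only at its front; symmetry needs the same at its end.\<close>

lemma alt_walk_snoc:
  "alt_walk E W u a \<Longrightarrow> {b, v} \<in> E \<Longrightarrow> alt_walk E (add_mset {a, b} W) u v"
proof (induction rule: alt_walk.induct)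
  case (edge u v' W)
  then show ?case
    using alt_walk.step[OF edge(1) alt_walk.edge[OF edge(2)]] by simp
next
  case (step u c W d v')
  then show ?case
    using alt_walk.step[OF step(1), of "add_mset {v', b} W" d v] by (simp add: add_mset_commute)
qed

lemma alt_walk_sym: "alt_walk E W u v \<Longrightarrow> alt_walk E W v u"
proof (induction rule: alt_walk.induct)
  case (edge u v W)
  then show ?case
    by (simp add: alt_walk.edge insert_commute)
next
  case (step u a W b v)
  then show ?case
    using alt_walk_snoc[OF step(3), of a u] by (simp add: insert_commute)
qed

definition edge_product :: "'v set multiset \<Rightarrow> 'v multiset" where
  "edge_product W = \<Sum>\<^sub># (image_mset mset_set W)"

text \<open>Edges may repeat in \<open>F\<close>, so for a monomial \<open>m\<close> in the vertices
  this is membership in the \<open>n\<close>-th power of the edge ideal;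
  \<open>edge_ideal_power\<close> confirms it.\<close>

definition divisible_by_edges :: "'v set set \<Rightarrow> nat \<Rightarrow> 'v multiset \<Rightarrow> bool" where
  "divisible_by_edges E n m \<longleftrightarrow> (\<exists>F. set_mset F \<subseteq> E \<and> size F = n \<and> edge_product F \<subseteq># m)"

lemma edge_product_simps [simp]:
  "edge_product {#} = {#}"
  "edge_product (add_mset e W) = mset_set e + edge_product W"
  "edge_product (W + W') = edge_product W + edge_product W'"
  by (simp_all add: edge_product_def)

locale finite_simple_graph =
  fixes V :: "'v set" and E :: "'v set set"
  assumes graph: "simple_graph V E"
begin

lemma finite_V: "finite V"
  using graph by (simp add: simple_graph_def)

lemma edgeD: "{x, y} \<in> E \<Longrightarrow> x \<noteq> y \<and> x \<in> V \<and> y \<in> V"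
  using graph unfolding simple_graph_def by force

lemma edgeE:
  assumes "e \<in> E"
  obtains x y where "e = {x, y}" "x \<noteq> y"
  using assms graph unfolding simple_graph_def by (meson card_2_iff)

lemma mset_edge: "{x, y} \<in> E \<Longrightarrow> mset_set {x, y} = {#x, y#}"
  using edgeD by fastforce

lemma finite_E: "finite E"
proof (rule finite_subset)
  show "E \<subseteq> Pow V"
    using graph unfolding simple_graph_def by blast
qed (simp add: finite_V)

lemma size_edge_product: "set_mset F \<subseteq> E \<Longrightarrow> size (edge_product F) = 2 * size F"
proof (induction F)
  case (add e F)
  have "card e = 2"
    using add.prems graph by (simp add: simple_graph_def)
  then show ?case
    using add by simp
qed simp

lemma set_edge_product: "set_mset F \<subseteq> E \<Longrightarrow> set_mset (edge_product F) = \<Union>(set_mset F)"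
proof (induction F)
  case (add e F)
  then have "e \<in> E"
    by simp
  have "finite e"
    by (rule edgeE[OF \<open>e \<in> E\<close>]) simp
  then show ?case
    using add by simp
qed simp

text \<open>A form of Berge's augmenting path lemma: it makes the colon ideal \<open>(I\<^sup>s\<^sup>+\<^sup>1 : W)\<close>, where \<open>W\<close> is a
  product of \<open>s\<close> edges, quadratic.\<close>

lemma alt_walk_exists:
  assumes "set_mset W \<subseteq> E" "set_mset F \<subseteq> E" "size F = Suc (size W)"
    and "edge_product F \<subseteq># edge_product W + m"
  shows "\<exists>u v. {#u, v#} \<subseteq># m \<and> alt_walk E W u v"
  using assms
proof (induction "size W" arbitrary: W F m)
  case 0
  then have "size F = 1"
    by simp
  then obtain f where f: "F = {#f#}"
    by (rule size_1_singleton_mset[THEN exE])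
  then have fE: "f \<in> E"
    using 0 by simp
  then obtain x y where xy: "f = {x, y}" "x \<noteq> y"
    using edgeE by metis
  have "W = {#}"
    using 0 by simp
  then have "{#x, y#} \<subseteq># m"
    using 0 f xy by simp
  then show ?case
    using fE xy(1) alt_walk.edge[of x y E W] by blast
next
  case (Suc s)
  \<comment> \<open>By degree some variable \<open>u\<close> occurs more often in the product of
    \<open>F\<close> than in that of \<open>W\<close>, and the excess must come from
    \<open>m\<close>. Such a \<open>u\<close> starts the walk.\<close>
  have "\<not> edge_product F \<subseteq># edge_product W"
    using size_mset_mono[of "edge_product F" "edge_product W"] size_edge_product Suc.prems(1-3) by fastforce
  then obtain u where u: "count (edge_product F) u > count (edge_product W) u"
    by (meson not_le subseteq_mset_def)
  have um: "u \<in># m"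
  proof -
    have "count (edge_product F) u \<le> count (edge_product W) u + count m u"
      using Suc.prems(4) by (metis count_union subseteq_mset_def)
    then have "count m u > 0"
      using u by linarith
    then show ?thesis
      by simp
  qed
  have "u \<in># edge_product F"
    using u by (metis count_greater_zero_iff gr_implies_not0 gr0I)
  then obtain f where f: "f \<in># F" "u \<in> f"
    using set_edge_product Suc.prems(2) by auto
  have "f \<in> E"
    using f Suc.prems(2) by blast
  then obtain a where a: "f = {u, a}" "u \<noteq> a"
    using edgeE[of f] f(2) by (metis insertE insert_commute singletonD)
  obtain F' where F': "F = add_mset f F'"
    using f(1) by (metis multi_member_split)
  have prod: "{#u, a#} + edge_product F' \<subseteq># edge_product W + m"
  proof -
    have "mset_set f = {#u, a#}"
      using mset_edge[of u a] a \<open>f \<in> E\<close> by (simp only:)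
    then have "edge_product F = {#u, a#} + edge_product F'"
      unfolding F' by (simp only: edge_product_simps)
    then show ?thesis
      using Suc.prems(4) by (simp only:)
  qed
  show ?case
  proof (cases "a \<in># edge_product W")
    case False
    have "a \<in># edge_product W + m"
      using mset_subset_eqD[OF prod, of a] by simp
    then have "a \<in># m"
      using False by simp
    then have "{#u, a#} \<subseteq># m"
      using um a(2) by (simp add: pair_subseteq_mset_iff)
    then show ?thesis
      using alt_walk.edge[of u a E W] a \<open>f \<in> E\<close> by blast
  next
    case True
    then obtain e where e: "e \<in># W" "a \<in> e"
      using set_edge_product Suc.prems(1) by auto
    have "e \<in> E"
      using e Suc.prems(1) by blast
    then obtain b where b: "e = {a, b}" "a \<noteq> b"
      using edgeE[of e] e(2) by (metis insertE insert_commute singletonD)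
    obtain W' where W': "W = add_mset e W'"
      using e(1) by (metis multi_member_split)
    obtain m' where m': "m = add_mset u m'"
      using um by (metis multi_member_split)
    \<comment> \<open>Cancelling \<open>u\<close> and \<open>a\<close> gives the same situation with
      one edge fewer on each side, where \<open>b\<close> takes the place of \<open>u\<close> in
      \<open>m\<close>.\<close>
    have "{#u, a#} + edge_product F' \<subseteq># {#u, a#} + (edge_product W' + add_mset b m')"
    proof -
      have "mset_set e = {#a, b#}"
        using mset_edge[of a b] b \<open>e \<in> E\<close> by (simp only:)
      then have "edge_product W + m = {#u, a#} + (edge_product W' + add_mset b m')"
        unfolding W' m' by (simp add: add_mset_commute)
      then show ?thesis
        using prod by (simp only:)
    qed
    then have "edge_product F' \<subseteq># edge_product W' + add_mset b m'"
      by (simp only: mset_subset_eq_mono_add_left_cancel)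
    then obtain x y where xy: "{#x, y#} \<subseteq># add_mset b m'" "alt_walk E W' x y"
      using Suc.hyps(1)[of W' F' "add_mset b m'"] Suc.hyps(2) Suc.prems(1-3) unfolding W' F' by auto
    have step: "alt_walk E W u z" if "alt_walk E W' b z" for z
      using alt_walk.step[of u a E W' b z] that a \<open>f \<in> E\<close> unfolding W' b(1) by simp
    show ?thesis
    proof (cases "{#x, y#} \<subseteq># m'")
      case True
      then have "{#x, y#} \<subseteq># m"
        unfolding m' by (rule subset_mset.order_trans) simp
      moreover have "alt_walk E W x y"
        using alt_walk_mono[OF xy(2), of "{#e#}"] unfolding W' by simp
      ultimately show ?thesis
        by blast
    next
      case False
      \<comment> \<open>The pair is not inside \<open>m'\<close>, so one end of the walk is the
        added copy of \<open>b\<close>; prolonging it through \<open>e\<close> and \<open>f\<close>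
        moves that end to \<open>u\<close>.\<close>
      have "x = b \<and> y \<in># m' \<or> y = b \<and> x \<in># m'"
        using xy(1) False by (auto simp: pair_subseteq_mset_iff split: if_splits)
      then show ?thesis
      proof
        assume "x = b \<and> y \<in># m'"
        then show ?thesis
          using step[of y] xy(2) by (intro exI[of _ u] exI[of _ y]) (simp add: m')
      next
        assume "y = b \<and> x \<in># m'"
        then show ?thesis
          using step[of x] alt_walk_sym[OF xy(2)] by (intro exI[of _ u] exI[of _ x]) (simp add: m')
      qed
    qed
  qed
qed

text \<open>Exchange the consumed edges for the arbitrary ones of the walk: these are one more, and
  they cover the same vertices together with the two ends.\<close>

lemma alt_walk_divisible:
  "alt_walk E W u v \<Longrightarrow> set_mset W \<subseteq> E \<Longrightarrow>
    divisible_by_edges E (Suc (size W)) (edge_product W + {#u, v#})"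
proof (induction rule: alt_walk.induct)
  case (edge u v W)
  then show ?case
    unfolding divisible_by_edges_def using mset_edge
    by (intro exI[of _ "add_mset {u, v} W"]) auto
next
  case (step u a W b v)
  then obtain F where F: "set_mset F \<subseteq> E" "size F = Suc (size W)"
    "edge_product F \<subseteq># edge_product W + {#b, v#}"
    unfolding divisible_by_edges_def by auto
  then show ?case
    unfolding divisible_by_edges_def using mset_edge step.hyps(1) step.prems
    by (intro exI[of _ "add_mset {u, a} F"]) (auto simp: add_mset_commute ac_simps)
qed

lemma divisible_by_edges_mono:
  "divisible_by_edges E n m \<Longrightarrow> m \<subseteq># m' \<Longrightarrow> divisible_by_edges E n m'"
  unfolding divisible_by_edges_def using subset_mset.order_trans by blast

lemma divisible_iff_alt_walk:
  assumes "set_mset W \<subseteq> E"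
  shows "divisible_by_edges E (Suc (size W)) (edge_product W + m) \<longleftrightarrow>
    (\<exists>u v. {#u, v#} \<subseteq># m \<and> alt_walk E W u v)"
proof
  assume "divisible_by_edges E (Suc (size W)) (edge_product W + m)"
  then show "\<exists>u v. {#u, v#} \<subseteq># m \<and> alt_walk E W u v"
    using alt_walk_exists[OF assms] unfolding divisible_by_edges_def by blast
next
  assume "\<exists>u v. {#u, v#} \<subseteq># m \<and> alt_walk E W u v"
  then obtain u v where "{#u, v#} \<subseteq># m" "alt_walk E W u v"
    by blast
  then show "divisible_by_edges E (Suc (size W)) (edge_product W + m)"
    using divisible_by_edges_mono[OF alt_walk_divisible[OF _ assms]] by (meson mset_subset_eq_mono_add_left_cancel)
qed

end

section \<open>Distances and packings\<close>

lemma alt_walk_iff: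
  "alt_walk E W u v \<longleftrightarrow> {u, v} \<in> E \<or>
    (\<exists>a b W'. W = add_mset {a, b} W' \<and> {u, a} \<in> E \<and> alt_walk E W' b v)"
  by (subst alt_walk.simps) blast

lemma alt_walk_empty: "alt_walk E {#} u v \<longleftrightarrow> {u, v} \<in> E"
  by (subst alt_walk_iff) simp

lemma alt_walk_single:
  "alt_walk E {#e#} u v \<longleftrightarrow> {u, v} \<in> E \<or> (\<exists>a b. e = {a, b} \<and> {u, a} \<in> E \<and> {b, v} \<in> E)"
  by (subst alt_walk_iff) (auto simp: alt_walk_empty)

lemma alt_walk_double:
  "alt_walk E {#e, f#} u v \<longleftrightarrow> {u, v} \<in> E \<or>
    (\<exists>a b. e = {a, b} \<and> {u, a} \<in> E \<and> alt_walk E {#f#} b v) \<or>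
    (\<exists>a b. f = {a, b} \<and> {u, a} \<in> E \<and> alt_walk E {#e#} b v)"
  by (subst alt_walk_iff) (auto simp: add_eq_conv_ex add_mset_eq_single)

text \<open>Since \<open>refl\<close> holds for every \<open>n\<close>, this means a walk of length
  at most \<open>n\<close>; bounds can then be added and weakened without talking about shortest
  paths.\<close>

inductive near :: "'v set set \<Rightarrow> nat \<Rightarrow> 'v \<Rightarrow> 'v \<Rightarrow> bool" for E where
  refl: "near E n u u"
| step: "{u, w} \<in> E \<Longrightarrow> near E n w v \<Longrightarrow> near E (Suc n) u v"

lemma near_edge: "{u, v} \<in> E \<Longrightarrow> near E (Suc n) u v"
  by (rule near.step[OF _ near.refl])

lemma near_trans: "near E n u v \<Longrightarrow> near E k v w \<Longrightarrow> near E (n + k) u w"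
proof (induction rule: near.induct)
  case (refl n u)
  from refl show ?case
  proof (induction arbitrary: n rule: near.induct)
    case (step u w k v)
    then show ?case
      using near.step[OF step(1) step(3)[of n]] by simp
  qed (rule near.refl)
qed (auto intro: near.intros)

lemma near_mono: "near E n u v \<Longrightarrow> n \<le> k \<Longrightarrow> near E k u v"
  using near_trans[OF near.refl, of E n u v "k - n"] by simp

lemma near_sym: "near E n u v \<Longrightarrow> near E n v u"
proof (induction rule: near.induct)
  case (step u w n v)
  then show ?case
    using near_trans[OF step(3), of 1 u] near_edge[of w u E 0] by (simp add: insert_commute)
qed (rule near.refl)

text \<open>A closed neighbourhood: \<open>near E 1\<close> includes equality.\<close>

definition nbhd :: "'v set set \<Rightarrow> 'v set \<Rightarrow> 'v set" where
  "nbhd E X = {y. \<exists>x\<in>X. near E 1 x y}"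

text \<open>The constant \<open>4 k - 3\<close> is chosen so that the neighbourhood of a cluster of weight \<open>k\<close> has
  diameter at most \<open>4 k - 1\<close> and hence meets a geodesic in at most \<open>4 k\<close> vertices.\<close>

definition cluster :: "'v set set \<Rightarrow> nat \<Rightarrow> 'v set \<Rightarrow> bool" where
  "cluster E k X \<longleftrightarrow> (X \<noteq> {} \<longrightarrow> 1 \<le> k) \<and> (\<forall>a\<in>X. \<forall>b\<in>X. near E (4 * k - 3) a b)"

lemma nbhd_edge: "{x, y} \<in> E \<Longrightarrow> x \<in> X \<Longrightarrow> y \<in> nbhd E X"
  unfolding nbhd_def using near_edge by fastforce

lemma nbhd_mono: "X \<subseteq> Y \<Longrightarrow> nbhd E X \<subseteq> nbhd E Y"
  unfolding nbhd_def by blast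

lemma nbhd_Un: "nbhd E (X \<union> Y) = nbhd E X \<union> nbhd E Y"
  unfolding nbhd_def by blast

lemma near_nbhd_cluster:
  assumes "cluster E k X" "p \<in> nbhd E X" "q \<in> nbhd E X"
  shows "near E (4 * k - 1) p q"
proof -
  obtain x y where xy: "x \<in> X" "y \<in> X" "near E 1 x p" "near E 1 y q"
    using assms(2,3) unfolding nbhd_def by blast
  then have "near E (4 * k - 3) x y" "1 \<le> k"
    using assms(1) unfolding cluster_def by auto
  then have "near E (1 + (4 * k - 3) + 1) p q"
    using xy near_sym near_trans by metis
  \<comment> \<open>With \<open>1 \<le> k\<close> the truncated subtraction is exact, and
    \<open>1 + (4 * k - 3) + 1 = 4 * k - 1\<close>.\<close>
  then show ?thesis
    using \<open>1 \<le> k\<close> by (auto elim: near_mono)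
qed

text \<open>Greedy choice: the minimum together with the next two integers accounts for at most
  three elements of \<open>I\<close>.\<close>

lemma exists_separated_subset:
  fixes I :: "nat set"
  assumes "finite I"
  shows "\<exists>J\<subseteq>I. card I \<le> 3 * card J \<and> (\<forall>i\<in>J. \<forall>j\<in>J. i < j \<longrightarrow> i + 3 \<le> j)"
  using assms
proof (induction "card I" arbitrary: I rule: less_induct)
  case less
  show ?case
  proof (cases "I = {}")
    case False
    define i where "i = Min I"
    have i: "i \<in> I" "\<And>j. j \<in> I \<Longrightarrow> i \<le> j"
      using False less.prems by (auto simp: i_def)
    let ?I = "I - {i, i + 1, i + 2}"
    have "card ?I < card I"
      using i(1) less.prems by (intro psubset_card_mono) auto
    then obtain J where J: "J \<subseteq> ?I" "card ?I \<le> 3 * card J" "\<forall>i\<in>J. \<forall>j\<in>J. i < j \<longrightarrow> i + 3 \<le> j"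
      using less.hyps[of ?I] less.prems by auto
    have "finite J"
      using J(1) less.prems by (meson finite_Diff finite_subset)
    moreover have "i \<notin> J"
      using J(1) by blast
    moreover have "card I \<le> card ?I + 3"
      using diff_card_le_card_Diff[of "{i, i + 1, i + 2}" I] by (simp add: card_insert_if)
    ultimately have "card I \<le> 3 * card (insert i J)"
      using J(2) by simp
    moreover have "i + 3 \<le> j" if "j \<in> J" for j
      using that J(1) i(2)[of j] by (cases "j = i \<or> j = i + 1 \<or> j = i + 2") auto
    moreover have "\<not> j < i" if "j \<in> J" for j
      using that J(1) i(2)[of j] by auto
    ultimately show ?thesis
      using J i(1) by (intro exI[of _ "insert i J"]) auto
  qed simp
qed

lemma card_le_of_diameter:
  fixes A :: "nat set"
  assumes "finite A" "\<And>i j. i \<in> A \<Longrightarrow> j \<in> A \<Longrightarrow> j \<le> i + n"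
  shows "card A \<le> Suc n"
proof (cases "A = {}")
  case False
  have "A \<subseteq> {Min A..Min A + n}"
    using assms(1) assms(2)[OF Min_in[OF assms(1) False]] by auto
  then have "card A \<le> card {Min A..Min A + n}"
    by (intro card_mono) auto
  then show ?thesis
    by simp
qed simp

section \<open>Components, geodesics and packings\<close>

context finite_simple_graph
begin

definition connection :: "('v \<times> 'v) set" where
  "connection = {(u, v). u \<in> V \<and> v \<in> V \<and> (\<exists>n. near E n u v)}"

lemma path_imp_near:
  assumes "successively (\<lambda>x y. {x, y} \<in> E) xs" "i \<le> j" "j < length xs"
  shows "near E (j - i) (xs ! i) (xs ! j)"
  using assms(2,3)
proof (induction j)
  case (Suc j)
  show ?case
  proof (cases "i = Suc j")
    case False
    then have "near E (j - i) (xs ! i) (xs ! j)"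
      using Suc by simp
    moreover have "{xs ! j, xs ! Suc j} \<in> E"
      using assms(1) Suc.prems by (simp add: successively_conv_nth)
    then have "near E 1 (xs ! j) (xs ! Suc j)"
      by (metis One_nat_def near_edge)
    ultimately have "near E (j - i + 1) (xs ! i) (xs ! Suc j)"
      by (rule near_trans)
    then show ?thesis
      using False Suc.prems by (simp add: Suc_diff_le)
  qed (simp add: near.refl)
qed (simp add: near.refl)

lemma near_imp_path:
  "near E n u v \<Longrightarrow> v \<in> V \<Longrightarrow> \<exists>xs. path_between V E u xs v \<and> length xs \<le> Suc n"
proof (induction rule: near.induct)
  case (refl n u)
  then show ?case
    by (intro exI[of _ "[u]"]) (simp add: path_between_def)
next
  case (step u w n v)
  then obtain xs where xs: "path_between V E w xs v" "length xs \<le> Suc n"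
    by blast
  show ?case
  proof (cases "u \<in> set xs")
    case True
    then obtain ys zs where "xs = ys @ u # zs"
      by (meson split_list)
    then show ?thesis
      using xs by (intro exI[of _ "u # zs"]) (auto simp: path_between_def successively_append_iff)
  next
    case False
    then show ?thesis
      using xs edgeD[OF step(1)] step(1)
      by (intro exI[of _ "u # xs"]) (auto simp: path_between_def successively_Cons)
  qed
qed

lemma path_iff_near:
  assumes "u \<in> V" "v \<in> V"
  shows "(\<exists>xs. path_between V E u xs v) \<longleftrightarrow> (\<exists>n. near E n u v)"
proof
  assume "\<exists>xs. path_between V E u xs v"
  then obtain xs where xs: "path_between V E u xs v"
    by blast
  then have "near E (length xs - 1 - 0) (xs ! 0) (xs ! (length xs - 1))"
    by (intro path_imp_near) (auto simp: path_between_def)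
  then show "\<exists>n. near E n u v"
    using xs by (auto simp: path_between_def hd_conv_nth last_conv_nth)
qed (use near_imp_path assms in blast)

lemma components_eq: "components V E = V // connection"
  unfolding components_def connection_def using path_iff_near by (intro arg_cong[of _ _ "(//) V"]) auto

lemma equiv_connection: "equiv V connection"
proof (rule equivI)
  show "connection \<subseteq> V \<times> V" "refl_on V connection"
    by (auto simp: refl_on_def connection_def intro: near.refl)
  show "sym connection"
    unfolding sym_def connection_def by (auto dest: near_sym)
  show "trans connection"
    using near_trans by (fastforce simp: trans_def connection_def)
qed

text \<open>\<open>g\<close> runs along a shortest path between two vertices that realize the
  diameter \<open>d\<close>. A walk of length \<open>n\<close> from \<open>g i\<close> to
  \<open>g j\<close> gives one of length \<open>i + n + (d - j)\<close> between the ends of the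
  path, and this is at least \<open>d\<close>.\<close>

lemma geodesic:
  assumes "V \<noteq> {}"
  obtains g where "\<And>i. i \<le> diameter V E \<Longrightarrow> g i \<in> V"
    and "\<And>i. i \<le> diameter V E \<Longrightarrow> (g 0, g i) \<in> connection"
    and "\<And>i j n. i \<le> diameter V E \<Longrightarrow> j \<le> diameter V E \<Longrightarrow> near E n (g i) (g j) \<Longrightarrow> j \<le> i + n"
proof -
  define d where "d = diameter V E"
  have fin: "finite (components V E)"
    unfolding components_eq by (rule finite_quotient[OF finite_V]) (use equiv_connection in \<open>auto simp: equiv_def\<close>)
  have "components V E \<noteq> {}"
    unfolding components_eq using assms by (auto simp: quotient_def)
  then have "d \<in> component_diameter V E ` components V E"
    unfolding d_def diameter_def using fin by (intro Max_in) auto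
  then obtain K where K: "K \<in> V // connection" "d = component_diameter V E K"
    unfolding components_eq by blast
  then have "K \<subseteq> V" "K \<noteq> {}"
    using equiv_connection in_quotient_imp_subset in_quotient_imp_non_empty by metis+
  have "finite (K \<times> K)" "K \<times> K \<noteq> {}"
    using \<open>K \<subseteq> V\<close> \<open>K \<noteq> {}\<close> finite_V by (auto intro: finite_subset)
  moreover have "{graph_dist V E u v | u v. u \<in> K \<and> v \<in> K} = (\<lambda>(u, v). graph_dist V E u v) ` (K \<times> K)"
    by auto
  ultimately have "d \<in> (\<lambda>(u, v). graph_dist V E u v) ` (K \<times> K)"
    unfolding K(2) component_diameter_def
    using Max_in[of "(\<lambda>(u, v). graph_dist V E u v) ` (K \<times> K)"] by (simp only: finite_imageI image_is_empty simp_thms)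
  then obtain u v where uv: "u \<in> K" "v \<in> K" "d = graph_dist V E u v"
    by auto
  have uvV: "u \<in> V" "v \<in> V"
    using uv \<open>K \<subseteq> V\<close> by auto
  have "(u, v) \<in> connection"
    using K(1) uv(1,2) equiv_connection in_quotient_imp_in_rel by fastforce
  then have "\<exists>l xs. path_between V E u xs v \<and> l = length xs - 1"
    using path_iff_near[OF uvV] unfolding connection_def by auto
  then have "\<exists>xs. path_between V E u xs v \<and> d = length xs - 1"
    unfolding uv(3) graph_dist_def by (rule LeastI_ex)
  then obtain xs where xs: "path_between V E u xs v" "d = length xs - 1"
    by blast
  then have len: "length xs = Suc d" and ends: "xs ! 0 = u" "xs ! d = v"
    and sub: "set xs \<subseteq> V" and succ: "successively (\<lambda>x y. {x, y} \<in> E) xs"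
    by (auto simp: path_between_def hd_conv_nth last_conv_nth)
  have inV: "xs ! i \<in> V" if "i \<le> d" for i
    using that sub len nth_mem[of i xs] by auto
  show thesis
  proof (rule that[of "(!) xs"], unfold d_def[symmetric])
    show "xs ! i \<in> V" if "i \<le> d" for i
      using that by (rule inV)
    show "(xs ! 0, xs ! i) \<in> connection" if "i \<le> d" for i
      using path_imp_near[OF succ, of 0 i] that len inV unfolding connection_def by auto
    show "j \<le> i + n" if "i \<le> d" "j \<le> d" "near E n (xs ! i) (xs ! j)" for i j n
    proof -
      have "near E i u (xs ! i)" "near E (d - j) (xs ! j) v"
        using path_imp_near[OF succ, of 0 i] path_imp_near[OF succ, of j d] that(1,2) len ends by auto
      then have "near E (i + n + (d - j)) u v"
        using that(3) near_trans by metis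
      then obtain ys where ys: "path_between V E u ys v" "length ys \<le> Suc (i + n + (d - j))"
        using near_imp_path uvV(2) by blast
      have "d \<le> length ys - 1"
        unfolding uv(3) graph_dist_def using ys(1) by (intro Least_le) blast
      then show ?thesis
        using ys(2) that(2) by linarith
    qed
  qed
qed

text \<open>In units of a third of a point of \<open>P\<close>, a cluster of weight \<open>k\<close>
  costs at most \<open>4 * k\<close>. The vertices of its neighbourhood are pairwise connected, so
  it removes either up to \<open>4 * k\<close> positions of the geodesic or one other component,
  worth 3. Two clusters suffice because at most two factors occur.\<close>

lemma packing_avoiding_clusters:
  assumes "V \<noteq> {}" "cluster E k X" "cluster E l Y" "k + l + 1 \<le> t"
  obtains P where "P \<subseteq> V" "P \<inter> nbhd E (X \<union> Y) = {}"
    and "\<And>p q. p \<in> P \<Longrightarrow> q \<in> P \<Longrightarrow> p \<noteq> q \<Longrightarrow> \<not> near E 2 p q"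
    and "\<lceil>(real (diameter V E) - 4 * real t + 5) / 3\<rceil> + int (card (components V E)) - 1 \<le> int (card P)"
proof -
  define d where "d = diameter V E"
  obtain g where g: "\<And>i. i \<le> d \<Longrightarrow> g i \<in> V" "\<And>i. i \<le> d \<Longrightarrow> (g 0, g i) \<in> connection"
    "\<And>i j n. i \<le> d \<Longrightarrow> j \<le> d \<Longrightarrow> near E n (g i) (g j) \<Longrightarrow> j \<le> i + n"
    using geodesic[OF assms(1)] unfolding d_def by metis
  define K where "K = connection `` {g 0}"
  define Q where "Q = components V E - {K}"
  define A where "A = (\<lambda>X. {i. i \<le> d \<and> g i \<in> nbhd E X})"
  define B where "B = (\<lambda>X. {C \<in> Q. C \<inter> nbhd E X \<noteq> {}})"
  have finite_comp: "finite (components V E)"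
    unfolding components_eq by (rule finite_quotient[OF finite_V]) (use equiv_connection in \<open>auto simp: equiv_def\<close>)
  have finQ: "finite Q"
    unfolding Q_def using finite_comp by simp
  have K: "K \<in> components V E"
    unfolding components_eq K_def using g(1)[of 0] by (simp add: quotientI)
  have in_component: "(p, q) \<in> connection" if "p \<in> C" "q \<in> C" "C \<in> components V E" for p q C
    using that equiv_connection unfolding components_eq by (meson in_quotient_imp_in_rel insert_subset subset_iff empty_subsetI)
  have component_eq: "C = D" if "p \<in> C" "q \<in> D" "C \<in> components V E" "D \<in> components V E" "near E n p q" for p q C D n
  proof -
    have "p \<in> V" "q \<in> V"
      using that equiv_connection in_quotient_imp_subset unfolding components_eq by fastforce+
    then have "(p, q) \<in> connection"
      using that(5) unfolding connection_def by blast
    then show ?thesis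
      using that(1-4) equiv_connection unfolding components_eq by (metis quotient_eq_iff)
  qed
  have gK: "g i \<in> K" if "i \<le> d" for i
    using g(2)[OF that] unfolding K_def by simp
  have kill: "card (A X) + 3 * card (B X) \<le> 4 * k" if cl: "cluster E k X" for k X
  proof (cases "X = {}")
    case True
    then show ?thesis
      unfolding A_def B_def nbhd_def by simp
  next
    case False
    then have k: "1 \<le> k"
      using cl unfolding cluster_def by simp
    note nn = near_nbhd_cluster[OF cl]
    have "card (A X) \<le> Suc (4 * k - 1)"
      using nn g(3) unfolding A_def by (intro card_le_of_diameter) auto
    moreover have "card (B X) \<le> 1"
    proof -
      have "C = D" if "C \<in> B X" "D \<in> B X" for C D
        using that component_eq nn unfolding B_def Q_def by blast
      moreover have "finite (B X)"
        using finQ unfolding B_def by simp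
      ultimately show ?thesis
        using card_le_Suc0_iff_eq[of "B X"] by auto
    qed
    moreover have "A X = {} \<or> B X = {}"
    proof (rule ccontr)
      assume "\<not> ?thesis"
      then obtain i C p where "i \<le> d" "g i \<in> nbhd E X" "C \<in> Q" "p \<in> C" "p \<in> nbhd E X"
        unfolding A_def B_def by blast
      then show False
        using component_eq[OF gK _ K, of i p C] nn unfolding Q_def by blast
    qed
    ultimately show ?thesis
      using k by auto
  qed
  define I where "I = {..d} - A X - A Y"
  obtain J where J: "J \<subseteq> I" "card I \<le> 3 * card J" "\<forall>i\<in>J. \<forall>j\<in>J. i < j \<longrightarrow> i + 3 \<le> j"
    using exists_separated_subset[of I] unfolding I_def by auto
  define Q' where "Q' = Q - B X - B Y"
  \<comment> \<open>A component in \<open>Q'\<close> misses both neighbourhoods entirely, so any of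
    its vertices serves.\<close>
  define r where "r = (\<lambda>C::'v set. SOME x. x \<in> C)"
  have r: "r C \<in> C" if "C \<in> Q" for C
  proof -
    have "C \<noteq> {}"
      using that equiv_connection in_quotient_imp_non_empty unfolding Q_def components_eq by auto
    then show ?thesis
      unfolding r_def by (simp add: some_in_eq)
  qed
  define P where "P = g ` J \<union> r ` Q'"
  have Jd: "i \<le> d" if "i \<in> J" for i
    using that J(1) unfolding I_def by auto
  have QC: "C \<in> components V E" "C \<noteq> K" if "C \<in> Q" for C
    using that unfolding Q_def by auto
  have Q'Q: "C \<in> Q" if "C \<in> Q'" for C
    using that unfolding Q'_def by auto
  have gg: "\<not> near E 2 (g i) (g j)" if "i \<in> J" "j \<in> J" "i \<noteq> j" for i j
  proof
    assume "near E 2 (g i) (g j)"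
    then have "near E 2 (g j) (g i)" "near E 2 (g i) (g j)"
      using near_sym by auto
    then have "j \<le> i + 2" "i \<le> j + 2"
      using g(3) Jd that by blast+
    then have "i \<noteq> j \<and> i \<le> j + 2 \<and> j \<le> i + 2"
      using that(3) by simp
    moreover have "i < j \<longrightarrow> i + 3 \<le> j" "j < i \<longrightarrow> j + 3 \<le> i"
      using J(3) that(1,2) by blast+
    ultimately show False
      by linarith
  qed
  have rr: "\<not> near E 2 (r C) (r D)" if "C \<in> Q'" "D \<in> Q'" "C \<noteq> D" for C D
    using that component_eq r Q'Q QC by metis
  have gr: "\<not> near E n (g i) (r C)" if "i \<in> J" "C \<in> Q'" for i C n
    using that component_eq[OF gK r K] Q'Q QC Jd by metis
  show thesis
  proof (rule that[of P])
    have "r C \<in> V" if "C \<in> Q" for C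
      using r[OF that] QC(1)[OF that] equiv_connection in_quotient_imp_subset unfolding components_eq by blast
    then show "P \<subseteq> V"
      unfolding P_def using g(1) Jd Q'Q by auto
    show "P \<inter> nbhd E (X \<union> Y) = {}"
      unfolding P_def nbhd_Un using J(1) r unfolding I_def A_def Q'_def B_def by fast
    show "\<not> near E 2 p q" if "p \<in> P" "q \<in> P" "p \<noteq> q" for p q
      using that gg rr gr near_sym unfolding P_def by (smt (verit) Un_iff imageE)
    have "inj_on g J"
    proof (rule inj_onI, rule ccontr)
      show False if "i \<in> J" "j \<in> J" "g i = g j" "i \<noteq> j" for i j
        using gg[of i j] near.refl[of E 2 "g j"] that by simp
    qed
    moreover have "inj_on r Q'"
    proof (rule inj_onI, rule ccontr)
      show False if "C \<in> Q'" "D \<in> Q'" "r C = r D" "C \<noteq> D" for C D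
        using rr[of C D] near.refl[of E 2 "r D"] that by simp
    qed
    moreover have "g ` J \<inter> r ` Q' = {}"
    proof -
      have "g i \<noteq> r C" if "i \<in> J" "C \<in> Q'" for i C
        using gr[OF that, of 0] near.refl[of E 0 "g i"] by auto
      then show ?thesis
        by blast
    qed
    moreover have "finite J" "finite Q'"
      using finite_subset[OF J(1)] finQ unfolding I_def Q'_def by auto
    ultimately have "card P = card J + card Q'"
      unfolding P_def by (simp add: card_Un_disjoint card_image)
    moreover have "d + 1 \<le> card I + card (A X) + card (A Y)"
      using diff_card_le_card_Diff[of "A X" "{..d}"] diff_card_le_card_Diff[of "A Y" "{..d} - A X"]
      unfolding I_def A_def by simp
    moreover have "card (components V E) \<le> card Q' + card (B X) + card (B Y) + 1"
    proof -
      have "card Q = card (components V E) - 1"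
        using K finite_comp unfolding Q_def by simp
      moreover have "finite (B X)" "finite (B Y)"
        using finQ unfolding B_def by auto
      ultimately show ?thesis
        using diff_card_le_card_Diff[of "B X" Q] diff_card_le_card_Diff[of "B Y" "Q - B X"]
        unfolding Q'_def by simp
    qed
    \<comment> \<open>Three times \<open>card P\<close> is at least \<open>d + 1\<close> from the
      geodesic plus \<open>3 * (card (components V E) - 1)\<close> from the other components, minus
      losses of at most \<open>4 * (k + l) \<le> 4 * t - 4\<close>.\<close>
    ultimately have "d + 3 * card (components V E) + 2 \<le> 3 * card P + 4 * t"
      using J(2) kill[OF assms(2)] kill[OF assms(3)] assms(4) by linarith
    then have "real d + 3 * real (card (components V E)) + 2 \<le> 3 * real (card P) + 4 * real t"
      by (simp flip: of_nat_mult of_nat_add add: of_nat_le_iff[symmetric, where 'a=real] del: of_nat_le_iff)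
    then have "(real d - 4 * real t + 5) / 3 \<le> real_of_int (int (card P) - int (card (components V E)) + 1)"
      by simp
    then have "\<lceil>(real d - 4 * real t + 5) / 3\<rceil> \<le> int (card P) - int (card (components V E)) + 1"
      by (simp only: ceiling_le_iff)
    then show "\<lceil>(real (diameter V E) - 4 * real t + 5) / 3\<rceil> + int (card (components V E)) - 1 \<le> int (card P)"
      unfolding d_def by linarith
  qed
qed

end

section \<open>The monomials outside a power of the edge ideal\<close>

lemma mset_size_le_2_cases:
  assumes "size W \<le> 2"
  shows "W = {#} \<or> (\<exists>x. W = {#x#}) \<or> (\<exists>x y. W = {#x, y#})"
proof (cases W)
  case (add x W1)
  then show ?thesis
  proof (cases W1)
    case (add y W2)
    then show ?thesis
      using \<open>W = add_mset x W1\<close> assms by auto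
  qed simp
qed simp

section \<open>Clusters covering the factors and the loops\<close>

context finite_simple_graph
begin

lemma cluster_clique:
  assumes "\<And>a b. a \<in> X \<Longrightarrow> b \<in> X \<Longrightarrow> a \<noteq> b \<Longrightarrow> {a, b} \<in> E"
  shows "cluster E 1 X"
proof -
  have "near E 1 a b" if "a \<in> X" "b \<in> X" for a b
  proof (cases "a = b")
    case True
    then show ?thesis
      by (simp add: near.refl)
  next
    case False
    then show ?thesis
      using near_edge[of a b E 0] assms that by simp
  qed
  then show ?thesis
    by (simp add: cluster_def)
qed

lemma cluster_empty: "cluster E 0 {}"
  by (simp add: cluster_def)

lemma cluster_edge: "e \<in> E \<Longrightarrow> cluster E 1 e"
  by (rule cluster_clique) (metis edgeE insert_commute insert_iff singletonD)

lemma edges_covered_by_clusters: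
  assumes "set_mset W \<subseteq> E" "size W \<le> 2"
  shows "\<exists>X Y k l. cluster E k X \<and> cluster E l Y \<and> k + l \<le> size W \<and> \<Union>(set_mset W) \<subseteq> X \<union> Y"
proof -
  consider "W = {#}" | e where "W = {#e#}" | e f where "W = {#e, f#}"
    using mset_size_le_2_cases[OF assms(2)] by blast
  then show ?thesis
  proof cases
    case 1
    then show ?thesis
      using cluster_empty by (intro exI[of _ "{}"] exI[of _ 0]) simp
  next
    case 2
    then show ?thesis
      using cluster_empty cluster_edge[of e] assms(1)
      by (intro exI[of _ e] exI[of _ "{}"] exI[of _ 1] exI[of _ 0]) simp
  next
    case 3
    then show ?thesis
      using cluster_edge[of e] cluster_edge[of f] assms(1)
      by (intro exI[of _ e] exI[of _ f] exI[of _ 1]) auto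
  qed
qed

text \<open>\<open>c a b p q\<close> is a closed walk of length 5, so its vertices are within 2 of
  \<open>c\<close> and within 4 of each other, which is less than \<open>4 * 2 - 3\<close>. As 5 is
  odd, each of \<open>a\<close>, \<open>b\<close>, \<open>p\<close>, \<open>q\<close> is reached
  from \<open>c\<close> in one of the two directions by an even number of steps, the last being
  \<open>e\<close> or \<open>f\<close>; appending the edge to \<open>c'\<close> gives the
  walk.\<close>

lemma pentagon_loop:
  assumes "{e, f} \<subseteq> E" "e = {a, b}" "f = {p, q}" "{c, a} \<in> E" "{b, p} \<in> E" "{q, c} \<in> E"
  shows "cluster E 2 (insert c (e \<union> f))"
    and "alt_walk E {#e, f#} c' c' \<Longrightarrow> alt_walk E {#e, f#} c c'"
proof -
  have ab: "{a, b} \<in> E" "{p, q} \<in> E"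
    using assms(1-3) by auto
  have "near E 2 c z" if "z \<in> insert c (e \<union> f)" for z
  proof -
    have "near E 2 c a" "near E 2 c q"
      using near_edge[of c a E 1] near_edge[of c q E 1] assms(4,6) by (simp_all add: insert_commute numeral_2_eq_2)
    moreover have "near E (Suc (Suc 0)) c b"
      using near.step[OF assms(4) near_edge[OF ab(1)], of 0] by simp
    moreover have "near E (Suc (Suc 0)) c p"
      using near.step[of c q E "Suc 0" p] near_edge[of q p E 0] ab(2) assms(6) by (simp add: insert_commute)
    moreover have "near E 2 c c"
      by (rule near.refl)
    ultimately show ?thesis
      using that assms(2,3) by (auto simp: numeral_2_eq_2)
  qed
  then have "near E (2 + 2) x y" if "x \<in> insert c (e \<union> f)" "y \<in> insert c (e \<union> f)" for x y
    using that near_sym near_trans by metis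
  then have "near E 5 x y" if "x \<in> insert c (e \<union> f)" "y \<in> insert c (e \<union> f)" for x y
    by (rule near_mono[of E "2 + 2"]) (use that in auto)
  then show "cluster E 2 (insert c (e \<union> f))"
    unfolding cluster_def by (simp del: insert_iff)
next
  assume "alt_walk E {#e, f#} c' c'"
  \<comment> \<open>There are no loops in \<open>E\<close>, so the closed walk at \<open>c'\<close>
    consumes an edge, and its first step leads to an end of \<open>e\<close> or
    \<open>f\<close>.\<close>
  then obtain z where z: "z \<in> e \<union> f" "{c', z} \<in> E"
    using edgeD unfolding alt_walk_double by blast
  have single: "alt_walk E {#{x, y}#} u v" if "{u, x} \<in> E" "{y, v} \<in> E" for x y u v
    using that unfolding alt_walk_single by blast
  have double: "alt_walk E {#{x, y}, g#} u v" if "{u, x} \<in> E" "alt_walk E {#g#} y v" for x y u v g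
    using alt_walk.step[OF that] by simp
  have short: "alt_walk E {#{x, y}, g#} u v" if "{u, x} \<in> E" "{y, v} \<in> E" for x y u v g
    by (rule double) (use that in \<open>auto intro: alt_walk.edge\<close>)
  have sym: "{x, y} \<in> E \<longleftrightarrow> {y, x} \<in> E" for x y
    by (simp add: insert_commute)
  consider "z = a" | "z = b" | "z = p" | "z = q"
    using z(1) assms(2,3) by blast
  then show "alt_walk E {#e, f#} c c'"
  proof cases
    case 1
    have "alt_walk E {#{q, p}, {b, a}#} c c'"
      by (rule double, use assms sym in blast, rule single) (use assms z 1 sym in blast)+
    then show ?thesis
      using assms(2,3) by (simp add: insert_commute add_mset_commute)
  next
    case 2
    have "alt_walk E {#{a, b}, f#} c c'"
      by (rule short) (use assms z 2 sym in blast)+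
    then show ?thesis
      using assms(2,3) by simp
  next
    case 3
    have "alt_walk E {#{q, p}, e#} c c'"
      by (rule short) (use assms z 3 sym in blast)+
    then show ?thesis
      using assms(2,3) by (simp add: insert_commute add_mset_commute)
  next
    case 4
    have "alt_walk E {#{a, b}, {p, q}#} c c'"
      by (rule double, use assms sym in blast, rule single) (use assms z 4 sym in blast)+
    then show ?thesis
      using assms(2,3) by simp
  qed
qed

text \<open>Two different members of \<open>C\<close> would be joined by a walk through
  \<open>e\<close>, against independence; so \<open>C\<close> has at most one element and
  \<open>e \<union> C\<close> is an edge or a triangle.\<close>

lemma triangle_cluster:
  assumes "set_mset W \<subseteq> E" "e \<in># W"
    and "\<And>c a. c \<in> C \<Longrightarrow> a \<in> e \<Longrightarrow> {c, a} \<in> E"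
    and "\<And>c c'. c \<in> C \<Longrightarrow> c' \<in> C \<Longrightarrow> c \<noteq> c' \<Longrightarrow> \<not> alt_walk E W c c'"
  shows "cluster E 1 (e \<union> C)"
proof (rule cluster_clique)
  have "e \<in> E"
    using assms(1,2) by blast
  then obtain x y where e: "e = {x, y}" "x \<noteq> y"
    by (rule edgeE)
  obtain W' where W: "W = {#e#} + W'"
    using assms(2) by (metis add_mset_add_single multi_member_split union_commute)
  have CC: "c = c'" if "c \<in> C" "c' \<in> C" for c c'
  proof (rule ccontr)
    have "alt_walk E {#e#} c c'"
      using assms(3)[OF that(1), of x] assms(3)[OF that(2), of y] e
      unfolding alt_walk_single by (metis insert_commute insertI1 insertI2)
    then have "alt_walk E W c c'"
      unfolding W by (rule alt_walk_mono)
    then show "c \<noteq> c' \<Longrightarrow> False"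
      using assms(4) that by blast
  qed
  show "{a, b} \<in> E" if "a \<in> e \<union> C" "b \<in> e \<union> C" "a \<noteq> b" for a b
  proof -
    have "a \<in> e \<and> b \<in> e \<or> a \<in> C \<and> b \<in> e \<or> a \<in> e \<and> b \<in> C"
      using that CC by blast
    then show ?thesis
      using assms(3)[of a b] assms(3)[of b a] e \<open>e \<in> E\<close> that(3) by (auto simp: insert_commute)
  qed
qed

text \<open>With at most two edges in \<open>W\<close>, a closed alternating walk is a triangle on an edge of \<open>W\<close> or a closed
  walk of length 5 through both edges. In the latter case every further loop vertex is
  even-connected to the first one.\<close>

lemma loops_covered_by_clusters:
  assumes "set_mset W \<subseteq> E" "size W \<le> 2"
    and loop: "\<And>c. c \<in> C \<Longrightarrow> alt_walk E W c c"
    and indep: "\<And>c c'. c \<in> C \<Longrightarrow> c' \<in> C \<Longrightarrow> c \<noteq> c' \<Longrightarrow> \<not> alt_walk E W c c'"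
  shows "\<exists>X Y k l. cluster E k X \<and> cluster E l Y \<and> k + l \<le> size W \<and> \<Union>(set_mset W) \<union> C \<subseteq> X \<union> Y"
proof -
  consider "W = {#}" | e where "W = {#e#}" | e f where "W = {#e, f#}"
    using mset_size_le_2_cases[OF assms(2)] by blast
  then show ?thesis
  proof cases
    case 1
    have "C = {}"
      using loop edgeD unfolding 1 alt_walk_empty by blast
    then show ?thesis
      using edges_covered_by_clusters[OF assms(1,2)] by simp
  next
    case 2
    have "{c, a} \<in> E" if c: "c \<in> C" and "a \<in> e" for c a
    proof -
      obtain x y where "e = {x, y}" "{c, x} \<in> E" "{y, c} \<in> E"
        using loop[OF c] edgeD unfolding 2 alt_walk_single by blast
      then show ?thesis
        using \<open>a \<in> e\<close> by (auto simp: insert_commute)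
    qed
    then have "cluster E 1 (e \<union> C)"
      using triangle_cluster[OF assms(1), of e C] indep unfolding 2 by auto
    then show ?thesis
      using cluster_empty 2 by (intro exI[of _ "e \<union> C"] exI[of _ "{}"] exI[of _ 1] exI[of _ 0]) simp
  next
    case 3
    have pentagon: ?thesis
      if c: "c \<in> C" and W: "W = {#e, f#}" and "e = {a, b}" "f = {p, q}" "{c, a} \<in> E" "{b, p} \<in> E" "{q, c} \<in> E"
      for c e f a b p q
    proof -
      have E: "{e, f} \<subseteq> E"
        using assms(1) W by auto
      note pent = pentagon_loop[OF E that(3-7)]
      \<comment> \<open>No second loop vertex can exist, so a single cluster of weight 2 takes the
        place of two of weight 1.\<close>
      have "C \<subseteq> {c}"
        using pent(2) loop indep c unfolding W by blast
      then show ?thesis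
        using pent(1) cluster_empty W
        by (intro exI[of _ "insert c (e \<union> f)"] exI[of _ "{}"] exI[of _ 2] exI[of _ 0]) auto
    qed
    show ?thesis
    proof (cases "\<forall>c\<in>C. (\<forall>a\<in>e. {c, a} \<in> E) \<or> (\<forall>a\<in>f. {c, a} \<in> E)")
      case True
      let ?C = "\<lambda>e. {c \<in> C. \<forall>a\<in>e. {c, a} \<in> E}"
      have "cluster E 1 (e \<union> ?C e)" "cluster E 1 (f \<union> ?C f)"
        using triangle_cluster[OF assms(1), of e "?C e"] triangle_cluster[OF assms(1), of f "?C f"] indep 3
        by auto
      moreover have "\<Union>(set_mset W) \<union> C \<subseteq> (e \<union> ?C e) \<union> (f \<union> ?C f)"
        using True 3 by auto
      ultimately show ?thesis
        using 3 by (intro exI[of _ "e \<union> ?C e"] exI[of _ "f \<union> ?C f"] exI[of _ 1]) simp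
    next
      case False
      then obtain c where c: "c \<in> C" "\<not> (\<forall>a\<in>e. {c, a} \<in> E)" "\<not> (\<forall>a\<in>f. {c, a} \<in> E)"
        by blast
      \<comment> \<open>\<open>c\<close> is not adjacent to both ends of \<open>g\<close>, so a walk
        that consumes only \<open>g\<close> cannot close up at \<open>c\<close>; it must go on
        through \<open>g'\<close>, which gives the closed walk of length 5.\<close>
      have step: "\<exists>p q. g' = {p, q} \<and> {b, p} \<in> E \<and> {q, c} \<in> E"
        if "g = {a, b}" "{c, a} \<in> E" "alt_walk E {#g'#} b c" "\<not> (\<forall>a\<in>g. {c, a} \<in> E)" for g g' a b
        using that unfolding alt_walk_single by (auto simp: insert_commute)
      have "alt_walk E {#e, f#} c c"
        using loop[OF c(1)] 3 by simp
      then consider a b where "e = {a, b}" "{c, a} \<in> E" "alt_walk E {#f#} b c"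
        | a b where "f = {a, b}" "{c, a} \<in> E" "alt_walk E {#e#} b c"
        using edgeD unfolding alt_walk_double by blast
      then show ?thesis
      proof cases
        case (1 a b)
        then show ?thesis
          using pentagon[OF c(1) 3] step[OF 1 c(2)] by blast
      next
        case (2 a b)
        have "W = {#f, e#}"
          using 3 by (simp add: add_mset_commute)
        then show ?thesis
          using pentagon[OF c(1) _ 2(1) _ 2(2)] step[OF 2 c(3)] by blast
      qed
    qed
  qed
qed

text \<open>A walk that is not a single edge first consumes an edge at a neighbour of
  \<open>u\<close>. Hence from a vertex outside the neighbourhood of \<open>W\<close>,
  even-connection is ordinary adjacency.\<close>

lemma alt_walk_nbhd: "alt_walk E W u v \<Longrightarrow> {u, v} \<in> E \<or> u \<in> nbhd E (\<Union>(set_mset W))"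
proof (subst (asm) alt_walk_iff, elim disjE exE conjE)
  fix a b W' assume "W = add_mset {a, b} W'" "{u, a} \<in> E"
  then show ?thesis
    using nbhd_edge[of a u E "\<Union>(set_mset W)"] by (simp add: insert_commute)
qed simp

text \<open>No edge divides \<open>m\<close>, so every edge of \<open>F\<close> uses up at least one
  variable of \<open>w\<close>. The induction removes the edge from \<open>F\<close> and its ends
  from \<open>w\<close> and \<open>m\<close>.\<close>

lemma divisible_independent_bound:
  assumes "set_mset F \<subseteq> E" "edge_product F \<subseteq># w + m" "\<And>f. f \<in> E \<Longrightarrow> \<not> mset_set f \<subseteq># m"
  shows "size F \<le> size w"
  using assms
proof (induction F arbitrary: w m)
  case (add f F)
  have "f \<in> E"
    using add.prems(1) by simp
  then obtain x y where xy: "f = {x, y}" "x \<noteq> y"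
    by (rule edgeE)
  then have f: "mset_set f = {#x, y#}"
    by simp
  have xym: "\<not> (x \<in># m \<and> y \<in># m)"
    using add.prems(3)[OF \<open>f \<in> E\<close>] f xy(2) by (simp add: pair_subseteq_mset_iff)
  have sub: "{#x, y#} + edge_product F \<subseteq># w + m"
    using add.prems(2) f by (simp only: edge_product_simps)
  have xwm: "x \<in># w + m" "y \<in># w + m"
    using mset_subset_eqD[OF sub] by simp_all
  have one: "size (add_mset f F) \<le> size w"
    if u: "u \<in># w" and "v \<in># m" and uv: "{#u, v#} = {#x, y#}" for u v
  proof -
    obtain w' m' where w': "w = add_mset u w'" and m': "m = add_mset v m'"
      using u \<open>v \<in># m\<close> by (meson multi_member_split)
    have "{#u, v#} + edge_product F \<subseteq># {#u, v#} + (w' + m')"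
      using sub unfolding uv[symmetric] w' m' by simp
    then have "edge_product F \<subseteq># w' + m'"
      by (rule mset_subset_eq_mono_add_left_cancel[THEN iffD1])
    moreover have "\<not> mset_set f \<subseteq># m'" if "f \<in> E" for f
    proof
      assume "mset_set f \<subseteq># m'"
      then have "mset_set f \<subseteq># m"
        unfolding m' by (rule subset_mset.order_trans) simp
      then show False
        using add.prems(3)[OF that] by simp
    qed
    ultimately have "size F \<le> size w'"
      using add.IH[of w' m'] add.prems(1) by simp
    then show ?thesis
      using w' by simp
  qed
  consider "x \<in># m" "y \<in># w" | "y \<in># m" "x \<in># w" | "x \<notin># m" "y \<notin># m" "x \<in># w" "y \<in># w"
    using xwm xym by auto
  then show ?case
  proof cases
    case 1
    then show ?thesis
      using one[of y x] by (simp add: add_mset_commute)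
  next
    case 2
    then show ?thesis
      using one[of x y] by simp
  next
    case 3
    then have "{#x, y#} \<subseteq># w"
      using xy(2) by (simp add: pair_subseteq_mset_iff)
    then obtain w' where w': "w = {#x, y#} + w'"
      by (metis subset_mset.le_iff_add)
    have "edge_product F \<subseteq># w' + m"
      using sub unfolding w' by (simp only: union_assoc mset_subset_eq_mono_add_left_cancel)
    then have "size F \<le> size w'"
      using add.IH[of w' m] add.prems by simp
    then show ?thesis
      using w' by simp
  qed
qed simp

text \<open>If \<open>size W < t - 1\<close>, then \<open>t \<le> 3\<close> forces \<open>2 * size W < t\<close>, and the condition on divisibility is
  automatic for independent \<open>m\<close>; this is why \<open>W'\<close> may be taken empty in that case.\<close>

lemma independent_part_cone_partition:
  assumes "V \<noteq> {}" "set_mset W \<subseteq> E" "size W < t" "t \<le> 3" "A \<subseteq> nbhd E (\<Union>(set_mset W))"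
    and b: "int b \<le> \<lceil>(real (diameter V E) - 4 * real t + 5) / 3\<rceil> + int (card (components V E)) - 1"
  shows "cone_partition V b {m. set_mset m \<subseteq> V - A \<and> (\<forall>f\<in>E. \<not> mset_set f \<subseteq># m) \<and>
    \<not> divisible_by_edges E t (edge_product W + m)}"
proof -
  define W' where "W' = (if Suc (size W) = t then W else {#})"
  have W'E: "set_mset W' \<subseteq> E" and W'W: "\<Union>(set_mset W') \<subseteq> \<Union>(set_mset W)"
    using assms(2) by (auto simp: W'_def)
  have size: "size W \<le> 2"
    using assms(3,4) by simp
  have pair: "mset_set f \<subseteq># m" if "f = {u, v}" "f \<in> E" "{#u, v#} \<subseteq># m" for f u v m
    using that mset_edge by simp
  have "(\<forall>f\<in>E. \<not> mset_set f \<subseteq># m) \<and> \<not> divisible_by_edges E t (edge_product W + m) \<longleftrightarrow>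
      (\<forall>u v. {#u, v#} \<subseteq># m \<longrightarrow> \<not> alt_walk E W' u v)" (is "?L \<longleftrightarrow> ?R") for m
  proof
    assume L: ?L
    show ?R
    proof (cases "Suc (size W) = t")
      case True
      then show ?thesis
        using L divisible_iff_alt_walk[OF assms(2), of m] by (auto simp: W'_def)
    next
      case False
      then show ?thesis
        using L pair by (auto simp: W'_def alt_walk_empty)
    qed
  next
    assume R: ?R
    have indep: "\<not> mset_set f \<subseteq># m" if f: "f \<in> E" for f
    proof -
      obtain x y where "f = {x, y}" "x \<noteq> y"
        using f by (rule edgeE)
      then show ?thesis
        using R alt_walk.edge[of x y E W'] f by auto
    qed
    moreover have "\<not> divisible_by_edges E t (edge_product W + m)"
    proof (cases "Suc (size W) = t")
      case True
      then show ?thesis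
        using R divisible_iff_alt_walk[OF assms(2), of m] by (auto simp: W'_def)
    next
      case False
      show ?thesis
      proof
        assume "divisible_by_edges E t (edge_product W + m)"
        then have "t \<le> 2 * size W"
          using divisible_independent_bound[OF _ _ indep] size_edge_product[OF assms(2)]
          unfolding divisible_by_edges_def by metis
        then show False
          using False assms(3,4) by linarith
      qed
    qed
    ultimately show ?L
      by blast
  qed
  then have "{m. set_mset m \<subseteq> V - A \<and> (\<forall>f\<in>E. \<not> mset_set f \<subseteq># m) \<and>
      \<not> divisible_by_edges E t (edge_product W + m)} =
    {m. set_mset m \<subseteq> V - A \<and> (\<forall>u v. {#u, v#} \<subseteq># m \<longrightarrow> \<not> alt_walk E W' u v)}"
    by simp
  moreover have "cone_partition V b \<dots>"
  proof (rule loop_graph_cone_partition)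
    fix C assume C: "C \<subseteq> V - A" "\<And>c. c \<in> C \<Longrightarrow> alt_walk E W' c c"
      "\<And>c c'. c \<in> C \<Longrightarrow> c' \<in> C \<Longrightarrow> c \<noteq> c' \<Longrightarrow> \<not> alt_walk E W' c c'"
    \<comment> \<open>The clusters must cover \<open>W\<close> even where \<open>W'\<close> is
      empty: \<open>P\<close> has to avoid \<open>A\<close>, which lies in the neighbourhood of
      \<open>W\<close>.\<close>
    have "\<exists>X Y k l. cluster E k X \<and> cluster E l Y \<and> k + l \<le> size W \<and> \<Union>(set_mset W) \<union> C \<subseteq> X \<union> Y"
    proof (cases "Suc (size W) = t")
      case True
      then show ?thesis
        using loops_covered_by_clusters[OF assms(2) size, of C] C by (simp add: W'_def)
    next
      case False
      then have "C = {}"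
        using C(2) edgeD unfolding W'_def by (metis alt_walk_empty equals0I)
      then show ?thesis
        using edges_covered_by_clusters[OF assms(2) size] by simp
    qed
    then obtain X Y k l where XY: "cluster E k X" "cluster E l Y" "k + l \<le> size W"
      "\<Union>(set_mset W) \<union> C \<subseteq> X \<union> Y"
      by blast
    then have "k + l + 1 \<le> t"
      using assms(3) by simp
    then obtain P where P: "P \<subseteq> V" "P \<inter> nbhd E (X \<union> Y) = {}"
      "\<And>p q. p \<in> P \<Longrightarrow> q \<in> P \<Longrightarrow> p \<noteq> q \<Longrightarrow> \<not> near E 2 p q"
      "\<lceil>(real (diameter V E) - 4 * real t + 5) / 3\<rceil> + int (card (components V E)) - 1 \<le> int (card P)"
      using packing_avoiding_clusters[OF assms(1) XY(1,2)] by metis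
    have disj: "P \<inter> nbhd E (\<Union>(set_mset W) \<union> C) = {}"
      using P(2) nbhd_mono[OF XY(4), of E] by blast
    \<comment> \<open>From a point of \<open>P\<close> only ordinary edges lead on, so the distances
      within \<open>P\<close> and from \<open>P\<close> to \<open>W\<close> and \<open>C\<close>
      imply all conditions on \<open>P\<close>.\<close>
    have walkP: "{p, z} \<in> E" if "p \<in> P" "alt_walk E W' p z" for p z
      using alt_walk_nbhd[OF that(2)] nbhd_mono[OF W'W, of E] disj that(1) unfolding nbhd_Un by blast
    have "b \<le> card P"
      using b P(4) by linarith
    moreover have "P \<subseteq> V - A"
      using P(1) assms(5) disj unfolding nbhd_Un by blast
    moreover have "\<not> alt_walk E W' p c" if "p \<in> P" "c \<in> C" for p c
    proof
      assume "alt_walk E W' p c"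
      then have "{c, p} \<in> E"
        using walkP[of p c] that(1) by (simp add: insert_commute)
      then show False
        using nbhd_edge[of c p E C] that disj unfolding nbhd_Un by blast
    qed
    moreover have "\<not> alt_walk E W' p q" if "p \<in> P" "q \<in> P" for p q
    proof
      assume "alt_walk E W' p q"
      then have "{p, q} \<in> E"
        using walkP that(1) by blast
      then show False
        using P(3)[OF that] near_edge[of p q E 1] edgeD by (auto simp: numeral_2_eq_2)
    qed
    moreover have "\<not> alt_walk E W' q z" if "p \<in> P" "q \<in> P" "p \<noteq> q" "alt_walk E W' p z" for p q z
    proof
      assume "alt_walk E W' q z"
      then have "{q, z} \<in> E" "{p, z} \<in> E"
        using walkP that by blast+
      then have "near E (Suc 1) p q"
        using near.step[of p z E 1 q] near_edge[of z q E 0] by (simp add: insert_commute)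
      then show False
        using P(3)[OF that(1-3)] by (simp add: numeral_2_eq_2)
    qed
    ultimately show "\<exists>P. b \<le> card P \<and> P \<subseteq> V - A \<and> (\<forall>p\<in>P. \<forall>c\<in>C. \<not> alt_walk E W' p c) \<and>
        (\<forall>p\<in>P. \<forall>q\<in>P. \<not> alt_walk E W' p q) \<and>
        (\<forall>p\<in>P. \<forall>q\<in>P. p \<noteq> q \<longrightarrow> (\<forall>z\<in>V - A. alt_walk E W' p z \<longrightarrow> \<not> alt_walk E W' q z))"
      by (intro exI[of _ P] conjI ballI impI) auto
  qed (use finite_V alt_walk_sym in auto)
  ultimately show ?thesis
    by simp
qed

text \<open>Edges are divided off one at a time: \<open>F\<close> is the set of edges already known not to divide, and
  dividing by \<open>e\<close> turns each \<open>f \<in> F\<close> that meets \<open>e\<close> into a forbidden variable, collected in \<open>A\<close>.\<close>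

lemma not_divisible_cone_partition:
  assumes "V \<noteq> {}" "t \<le> 3"
    and b: "int b \<le> \<lceil>(real (diameter V E) - 4 * real t + 5) / 3\<rceil> + int (card (components V E)) - 1"
    and "set_mset W \<subseteq> E" "F \<subseteq> E" "A \<subseteq> nbhd E (\<Union>(set_mset W))"
  shows "cone_partition V b {m. set_mset m \<subseteq> V - A \<and> (\<forall>f\<in>F. \<not> mset_set f \<subseteq># m) \<and>
    \<not> divisible_by_edges E t (edge_product W + m)}"
  using assms(4-)
proof (induction "t - size W + card (E - F)" arbitrary: W F A rule: less_induct)
  case less
  define S where "S = (\<lambda>W F A. {m. set_mset m \<subseteq> V - A \<and> (\<forall>f\<in>F. \<not> mset_set f \<subseteq># m) \<and>
    \<not> divisible_by_edges E t (edge_product W + m)})"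
  have "cone_partition V b (S W F A)"
  proof (cases "size W < t")
    case False
    \<comment> \<open>\<open>W\<close> alone already contains \<open>t\<close> edges, so no monomial
      is left.\<close>
    have "divisible_by_edges E t (edge_product W + m)" for m
    proof -
      obtain W1 W2 where "W = W1 + W2" "size W1 = t"
      proof -
        obtain es where es: "W = mset es"
          using ex_mset by metis
        show thesis
          by (rule that[of "mset (take t es)" "mset (drop t es)"])
            (use False es in \<open>simp_all flip: mset_append\<close>)
      qed
      then show ?thesis
        using less.prems(1) unfolding divisible_by_edges_def by (intro exI[of _ W1]) auto
    qed
    then show ?thesis
      by (simp add: S_def cone_partition.empty)
  next
    case True
    show ?thesis
    proof (cases "F = E")
      case True
      then show ?thesis
        unfolding S_def using independent_part_cone_partition[OF assms(1) less.prems(1) \<open>size W < t\<close> assms(2) less.prems(3) b]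
        by simp
    next
      case False
      then obtain e where e: "e \<in> E" "e \<notin> F"
        using less.prems(2) by blast
      then obtain x y where xy: "e = {x, y}" "x \<noteq> y"
        using edgeE by metis
      then have me: "mset_set e = {#x, y#}"
        by simp
      have 1: "cone_partition V b (S W (insert e F) A)"
        unfolding S_def
      proof (rule less.hyps)
        have "card (E - insert e F) < card (E - F)"
          using e finite_E by (intro psubset_card_mono) auto
        then show "t - size W + card (E - insert e F) < t - size W + card (E - F)"
          by simp
      qed (use less.prems e in auto)
      have 2: "cone_partition V b ((+) (mset_set e) ` {m. mset_set e + m \<in> S W F A})"
      proof (cases "e \<inter> A = {}")
        case False
        have "{m. mset_set e + m \<in> S W F A} = {}"
          using False xy unfolding S_def me by auto
        then show ?thesis
          by (simp add: cone_partition.empty)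
      next
        case True
        define A' where "A' = A \<union> {z. \<exists>a\<in>e. {a, z} \<in> F}"
        have "mset_set f \<subseteq># mset_set e + m \<longleftrightarrow> mset_set f \<subseteq># m \<or> (\<exists>a\<in>e. \<exists>z\<in>#m. f = {a, z})"
          if "f \<in> F" for f m
        proof -
          have "f \<in> E" "f \<noteq> e"
            using that less.prems(2) e(2) by auto
          then obtain p q where pq: "f = {p, q}" "p \<noteq> q"
            using edgeE by metis
          have mf: "mset_set f \<subseteq># M \<longleftrightarrow> p \<in># M \<and> q \<in># M" for M
            using pq by (simp add: pair_subseteq_mset_iff)
          \<comment> \<open>\<open>f\<close> is not \<open>e\<close>, so \<open>e\<close> supplies
            at most one of its ends; if it supplies one, the condition left on \<open>m\<close>
            concerns a single variable.\<close>
          have "\<not> (p \<in> e \<and> q \<in> e)"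
            using \<open>f \<noteq> e\<close> pq xy by auto
          then show ?thesis
            unfolding mf me using pq xy by (auto simp: doubleton_eq_iff)
        qed
        then have "{m. mset_set e + m \<in> S W F A} = S (add_mset e W) F A'"
          using True e(1) edgeD[of x y] xy unfolding S_def A'_def
          by (auto simp: me ac_simps)
        \<comment> \<open>\<open>F\<close> is unchanged, so \<open>e\<close> may be divided off
          again; here the measure decreases through the growth of \<open>W\<close>.\<close>
        moreover have "cone_partition V b (S (add_mset e W) F A')"
          unfolding S_def
        proof (rule less.hyps)
          show "t - size (add_mset e W) + card (E - F) < t - size W + card (E - F)"
            using \<open>size W < t\<close> by simp
          show "A' \<subseteq> nbhd E (\<Union>(set_mset (add_mset e W)))"
            using less.prems(2,3) nbhd_edge[of _ _ E e] unfolding A'_def by (auto simp: nbhd_Un)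
        qed (use less.prems e in auto)
        ultimately show ?thesis
          using e(1) edgeD[of x y] xy by (intro cone_partition_shift) (auto simp: me)
      qed
      have "S W F A = S W (insert e F) A \<union> (+) (mset_set e) ` {m. mset_set e + m \<in> S W F A}"
      proof (intro equalityI subsetI)
        fix m assume m: "m \<in> S W F A"
        show "m \<in> S W (insert e F) A \<union> (+) (mset_set e) ` {m. mset_set e + m \<in> S W F A}"
        proof (cases "mset_set e \<subseteq># m")
          case True
          then obtain m' where "m = mset_set e + m'"
            by (metis subset_mset.le_iff_add)
          then show ?thesis
            using m by blast
        next
          case False
          then show ?thesis
            using m unfolding S_def by blast
        qed
      qed (auto simp: S_def)
      moreover have "S W (insert e F) A \<inter> (+) (mset_set e) ` {m. mset_set e + m \<in> S W F A} = {}"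
        by (auto simp: S_def)
      ultimately show ?thesis
        using cone_partition_Un[OF 1 2] by simp
    qed
  qed
  then show ?case
    by (simp add: S_def)
qed

end

section \<open>Stanley decompositions of quotients by monomial ideals\<close>

lemma carrier_mpoly_ring: "f \<in> carrier (mpoly_ring Z) \<longleftrightarrow> (\<forall>m\<in>Poly_Mapping.keys f. Poly_Mapping.keys m \<subseteq> Z)"
  by (simp add: mpoly_ring_def)

lemma mpoly_ring_simps [simp]:
  "monoid.mult (mpoly_ring Z) = (*)" "one (mpoly_ring Z) = 1" "zero (mpoly_ring Z) = 0" "add (mpoly_ring Z) = (+)"
  by (simp_all add: mpoly_ring_def)

lemma mpoly_ring_closed:
  fixes f g :: "('v, 'k::field) mpoly"
  shows "f \<in> carrier (mpoly_ring Z) \<Longrightarrow> g \<in> carrier (mpoly_ring Z) \<Longrightarrow> f + g \<in> carrier (mpoly_ring Z)"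
    "f \<in> carrier (mpoly_ring Z) \<Longrightarrow> g \<in> carrier (mpoly_ring Z) \<Longrightarrow> f * g \<in> carrier (mpoly_ring Z)"
    "f \<in> carrier (mpoly_ring Z) \<Longrightarrow> - f \<in> carrier (mpoly_ring Z)"
    "0 \<in> carrier (mpoly_ring Z)" "1 \<in> carrier (mpoly_ring Z)"
proof -
  assume f: "f \<in> carrier (mpoly_ring Z)"
  then show "- f \<in> carrier (mpoly_ring Z)"
    by (simp add: carrier_mpoly_ring in_keys_iff)
  assume g: "g \<in> carrier (mpoly_ring Z)"
  show "f + g \<in> carrier (mpoly_ring Z)"
    using f g keys_add[of f g] unfolding carrier_mpoly_ring by blast
  show "f * g \<in> carrier (mpoly_ring Z)"
    unfolding carrier_mpoly_ring
  proof
    fix m assume "m \<in> Poly_Mapping.keys (f * g)"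
    then obtain a b where "a \<in> Poly_Mapping.keys f" "b \<in> Poly_Mapping.keys g" "m = a + b"
      using keys_mult[of f g] by blast
    then show "Poly_Mapping.keys m \<subseteq> Z"
      using f g keys_add[of a b] unfolding carrier_mpoly_ring by blast
  qed
qed (simp_all add: carrier_mpoly_ring)

lemma mpoly_ring_cring: "cring (mpoly_ring Z :: ('v, 'k::field) mpoly ring)"
proof (rule cringI)
  show "abelian_group (mpoly_ring Z :: ('v, 'k) mpoly ring)"
  proof (rule abelian_groupI)
    show "\<exists>y\<in>carrier (mpoly_ring Z). y \<oplus>\<^bsub>mpoly_ring Z\<^esub> x = \<zero>\<^bsub>mpoly_ring Z\<^esub>"
      if "x \<in> carrier (mpoly_ring Z)" for x :: "('v, 'k) mpoly"
      using mpoly_ring_closed(3)[OF that] by (intro bexI[of _ "- x"]) auto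
  qed (auto simp: mpoly_ring_closed ac_simps)
  show "Group.comm_monoid (mpoly_ring Z :: ('v, 'k) mpoly ring)"
    by (rule comm_monoidI) (auto simp: mpoly_ring_closed ac_simps)
qed (auto simp: distrib_right)

lemma mpoly_ring_a_inv:
  fixes f :: "('v, 'k::field) mpoly"
  assumes "f \<in> carrier (mpoly_ring Z)"
  shows "\<ominus>\<^bsub>mpoly_ring Z\<^esub> f = - f"
proof -
  interpret cring "mpoly_ring Z :: ('v, 'k) mpoly ring"
    by (rule mpoly_ring_cring)
  show ?thesis
    using minus_equality[of "- f" f] assms by (simp add: mpoly_ring_closed)
qed

lemma monom_in_mpoly_ring: "monom m \<in> carrier (mpoly_ring Z) \<longleftrightarrow> Poly_Mapping.keys m \<subseteq> Z"
  by (simp add: monom_def carrier_mpoly_ring)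

definition restrict_keys :: "'a set \<Rightarrow> ('a \<Rightarrow>\<^sub>0 'b::comm_monoid_add) \<Rightarrow> 'a \<Rightarrow>\<^sub>0 'b" where
  "restrict_keys S f = (\<Sum>m\<in>Poly_Mapping.keys f \<inter> S. Poly_Mapping.single m (Poly_Mapping.lookup f m))"

lemma lookup_restrict_keys:
  "Poly_Mapping.lookup (restrict_keys S f) m = (if m \<in> S then Poly_Mapping.lookup f m else 0)"
proof -
  have "Poly_Mapping.lookup (restrict_keys S f) m =
      (\<Sum>x\<in>Poly_Mapping.keys f \<inter> S. if x = m then Poly_Mapping.lookup f x else 0)"
    unfolding restrict_keys_def lookup_sum by (intro sum.cong) (auto simp: lookup_single when_def)
  also have "\<dots> = (if m \<in> S then Poly_Mapping.lookup f m else 0)"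
    by (simp add: sum.delta' in_keys_iff)
  finally show ?thesis .
qed

lemma keys_restrict_keys: "Poly_Mapping.keys (restrict_keys S f) = Poly_Mapping.keys f \<inter> S"
  by (auto simp: in_keys_iff lookup_restrict_keys split: if_splits)

lemma poly_mapping_sum_single:
  "f = (\<Sum>m\<in>Poly_Mapping.keys f. Poly_Mapping.single m (Poly_Mapping.lookup f m))"
proof -
  have "restrict_keys UNIV f = f"
    by (rule poly_mapping_eqI) (simp add: lookup_restrict_keys)
  then show ?thesis
    by (simp add: restrict_keys_def)
qed

text \<open>For general \<open>A\<close> this is just a subspace; it is an ideal when
  \<open>A\<close> is closed under multiples, as \<open>monomial_quotient\<close> assumes.\<close>

definition monomial_ideal :: "'v set \<Rightarrow> ('v \<Rightarrow>\<^sub>0 nat) set \<Rightarrow> ('v, 'k::field) mpoly set" where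
  "monomial_ideal V A = {f \<in> carrier (mpoly_ring V). Poly_Mapping.keys f \<subseteq> A}"

section \<open>Quotients by monomial ideals and their Stanley spaces\<close>

locale monomial_quotient =
  fixes V :: "'v set" and A :: "('v \<Rightarrow>\<^sub>0 nat) set" and J :: "('v, 'k::field) mpoly set"
  assumes A_up: "a \<in> A \<Longrightarrow> m + a \<in> A" and J_def: "J = monomial_ideal V A"
begin

abbreviation R :: "('v, 'k) mpoly ring" where "R \<equiv> mpoly_ring V"
abbreviation M where "M \<equiv> quotient_module R J"

sublocale R: cring R
  by (rule mpoly_ring_cring)

lemma in_J: "f \<in> J \<longleftrightarrow> f \<in> carrier R \<and> Poly_Mapping.keys f \<subseteq> A"
  by (simp add: J_def monomial_ideal_def)

sublocale J: ideal J R
proof (rule idealI)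
  show "subgroup J (add_monoid R)"
  proof (rule subgroup.intro)
    show "x \<otimes>\<^bsub>add_monoid R\<^esub> y \<in> J" if "x \<in> J" "y \<in> J" for x y
      using that keys_add[of x y] by (auto simp: in_J mpoly_ring_closed)
    show "inv\<^bsub>add_monoid R\<^esub> x \<in> J" if "x \<in> J" for x
      using that mpoly_ring_a_inv[of x V] by (auto simp: in_J mpoly_ring_closed a_inv_def in_keys_iff)
  qed (auto simp: in_J mpoly_ring_closed)
  have mult: "x * a \<in> J" if "a \<in> J" "x \<in> carrier R" for a x
  proof -
    have "Poly_Mapping.keys (x * a) \<subseteq> A"
      using that keys_mult[of x a] A_up by (force simp: in_J)
    then show ?thesis
      using that by (simp add: in_J mpoly_ring_closed)
  qed
  then show "x \<otimes>\<^bsub>R\<^esub> a \<in> J" "a \<otimes>\<^bsub>R\<^esub> x \<in> J" if "a \<in> J" "x \<in> carrier R" for a x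
    using that by (simp_all add: mult.commute)
qed (rule R.ring_axioms)

definition coset :: "('v, 'k) mpoly \<Rightarrow> ('v, 'k) mpoly set" where
  "coset f = J +>\<^bsub>R\<^esub> f"

lemma coset_alt: "coset f = (\<lambda>h. h + f) ` J"
  by (auto simp: coset_def a_r_coset_def')

lemma coset_eq_iff:
  assumes "f \<in> carrier R" "g \<in> carrier R"
  shows "coset f = coset g \<longleftrightarrow> f - g \<in> J"
proof
  assume "coset f = coset g"
  moreover have "f \<in> coset f"
    using J.zero_closed by (force simp: coset_alt)
  ultimately show "f - g \<in> J"
    by (auto simp: coset_alt)
next
  assume d: "f - g \<in> J"
  have "- (f - g) \<in> J"
    using J.a_inv_closed[OF d] mpoly_ring_a_inv[of "f - g" V] J.Icarr[OF d] by simp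
  then have "h + (f - g) \<in> J" "h + (g - f) \<in> J" if "h \<in> J" for h
    using J.a_closed[OF that d] J.a_closed[OF that, of "- (f - g)"] by simp_all
  moreover have "h + f = h + (f - g) + g" "h + g = h + (g - f) + f" for h
    by simp_all
  ultimately show "coset f = coset g"
    unfolding coset_alt by (metis (no_types, lifting) image_iff subsetI subset_antisym)
qed

lemma carrier_M: "carrier M = coset ` carrier R"
  by (auto simp: quotient_module_def FactRing_def A_RCOSETS_def' coset_def)

lemma zero_M: "\<zero>\<^bsub>M\<^esub> = coset 0"
  by (simp add: quotient_module_def FactRing_def coset_alt)

lemma add_M: "f \<in> carrier R \<Longrightarrow> g \<in> carrier R \<Longrightarrow> coset f \<oplus>\<^bsub>M\<^esub> coset g = coset (f + g)"
  using J.a_rcos_sum[of f g] by (simp add: quotient_module_def FactRing_def coset_def)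

lemma smult_M: "f \<in> carrier R \<Longrightarrow> g \<in> carrier R \<Longrightarrow> f \<odot>\<^bsub>M\<^esub> coset g = coset (f * g)"
  using J.rcoset_mult_add[of f g] by (simp add: quotient_module_def FactRing_def coset_def)

lemma abelian_group_M: "abelian_group M"
proof (rule abelian_groupI)
  show "\<exists>y\<in>carrier M. y \<oplus>\<^bsub>M\<^esub> x = \<zero>\<^bsub>M\<^esub>" if "x \<in> carrier M" for x
  proof -
    obtain f where f: "x = coset f" "f \<in> carrier R"
      using \<open>x \<in> carrier M\<close> by (auto simp: carrier_M)
    then show ?thesis
      by (intro bexI[of _ "coset (- f)"]) (auto simp: carrier_M add_M zero_M mpoly_ring_closed)
  qed
qed (auto simp: carrier_M add_M zero_M mpoly_ring_closed ac_simps)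

sublocale M: abelian_group M
  by (rule abelian_group_M)

lemma a_inv_M: "f \<in> carrier R \<Longrightarrow> inv\<^bsub>add_monoid M\<^esub> coset f = coset (- f)"
proof -
  assume f: "f \<in> carrier R"
  then have "coset (- f) \<oplus>\<^bsub>M\<^esub> coset f = \<zero>\<^bsub>M\<^esub>"
    by (simp add: add_M mpoly_ring_closed zero_M)
  then have "\<ominus>\<^bsub>M\<^esub> coset f = coset (- f)"
    using f by (intro M.minus_equality) (auto simp: carrier_M mpoly_ring_closed)
  then show ?thesis
    by (simp add: a_inv_def)
qed

lemma sum_closed: "finite I \<Longrightarrow> (\<And>i. i \<in> I \<Longrightarrow> f i \<in> carrier R) \<Longrightarrow> (\<Sum>i\<in>I. f i) \<in> carrier R"
  by (induction I rule: finite_induct) (auto simp: mpoly_ring_closed)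

lemma finsum_coset:
  "finite I \<Longrightarrow> (\<And>i. i \<in> I \<Longrightarrow> f i \<in> carrier R) \<Longrightarrow> (\<Oplus>\<^bsub>M\<^esub>i\<in>I. coset (f i)) = coset (\<Sum>i\<in>I. f i)"
proof (induction I rule: finite_induct)
  case (insert i I)
  then have "(\<Oplus>\<^bsub>M\<^esub>i\<in>insert i I. coset (f i)) = coset (f i) \<oplus>\<^bsub>M\<^esub> (\<Oplus>\<^bsub>M\<^esub>i\<in>I. coset (f i))"
    by (intro M.finsum_insert) (auto simp: carrier_M)
  then show ?case
    using insert by (simp add: add_M sum_closed)
qed (simp add: zero_M)

definition supported :: "('v \<Rightarrow>\<^sub>0 nat) set \<Rightarrow> ('v, 'k) mpoly set" where
  "supported S = {f \<in> carrier R. Poly_Mapping.keys f \<subseteq> S}"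

text \<open>A coset modulo \<open>J\<close> determines the coefficients at the monomials outside
  \<open>A\<close> and nothing else. A partition of these monomials therefore splits the quotient:
  for existence a representative is restricted to each class, for uniqueness coefficients are
  compared.\<close>

lemma direct_sum_supported:
  assumes disj: "\<And>i j. i < length Ss \<Longrightarrow> j < length Ss \<Longrightarrow> i \<noteq> j \<Longrightarrow> Ss ! i \<inter> Ss ! j = {}"
    and cover: "\<Union>(set Ss) = {m. Poly_Mapping.keys m \<subseteq> V \<and> m \<notin> A}"
  shows "direct_sum_decomposition M (map (\<lambda>S. coset ` supported S) Ss)"
proof -
  let ?n = "length Ss"
  have lookup_sum_parts: "Poly_Mapping.lookup (\<Sum>i<?n. f i) m = Poly_Mapping.lookup (f j) m"
    if "j < ?n" "m \<in> Ss ! j" "\<And>i. i < ?n \<Longrightarrow> Poly_Mapping.keys (f i) \<subseteq> Ss ! i" for f :: "nat \<Rightarrow> ('v, 'k) mpoly" and j m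
  proof -
    have "Poly_Mapping.lookup (f i) m = 0" if "i < ?n" "i \<noteq> j" for i
      using disj[OF that(1) \<open>j < ?n\<close> that(2)] \<open>m \<in> Ss ! j\<close> \<open>\<And>i. i < ?n \<Longrightarrow> Poly_Mapping.keys (f i) \<subseteq> Ss ! i\<close>[OF that(1)]
      by (auto simp: in_keys_iff)
    then have "(\<Sum>i<?n. Poly_Mapping.lookup (f i) m) = (\<Sum>i<?n. if i = j then Poly_Mapping.lookup (f i) m else 0)"
      by (intro sum.cong) auto
    then show ?thesis
      using that(1) by (simp add: lookup_sum)
  qed
  have "\<exists>!w. w \<in> (\<Pi>\<^sub>E i\<in>{..<?n}. coset ` supported (Ss ! i)) \<and> x = (\<Oplus>\<^bsub>M\<^esub>i\<in>{..<?n}. w i)"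
    if x: "x \<in> carrier M" for x
  proof (rule ex_ex1I)
    obtain f where f: "f \<in> carrier R" "x = coset f"
      using x by (auto simp: carrier_M)
    define g where "g = (\<lambda>i. restrict_keys (Ss ! i) f)"
    have gs: "g i \<in> supported (Ss ! i)" for i
      using f(1) by (simp add: g_def supported_def keys_restrict_keys carrier_mpoly_ring)
    then have gR: "g i \<in> carrier R" for i
      unfolding supported_def by blast
    have sumR: "(\<Sum>i<?n. g i) \<in> carrier R"
      using gR by (intro sum_closed) auto
    have "Poly_Mapping.lookup (f - (\<Sum>i<?n. g i)) m = 0" if "Poly_Mapping.keys m \<subseteq> V" "m \<notin> A" for m
    proof -
      have "m \<in> \<Union>(set Ss)"
        using that cover by blast
      then obtain j where "j < ?n" "m \<in> Ss ! j"
        by (auto simp: in_set_conv_nth)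
      then have "Poly_Mapping.lookup (\<Sum>i<?n. g i) m = Poly_Mapping.lookup f m"
        using lookup_sum_parts[of j m g] by (simp add: g_def keys_restrict_keys lookup_restrict_keys)
      then show ?thesis
        by (simp add: lookup_minus)
    qed
    moreover have "f - (\<Sum>i<?n. g i) \<in> carrier R"
      using mpoly_ring_closed(1)[OF f(1) mpoly_ring_closed(3)[OF sumR]] by simp
    ultimately have "f - (\<Sum>i<?n. g i) \<in> J"
      unfolding in_J by (auto simp: in_keys_iff carrier_mpoly_ring)
    then have "x = coset (\<Sum>i<?n. g i)"
      using coset_eq_iff[OF f(1) sumR] f(2) by simp
    also have "\<dots> = (\<Oplus>\<^bsub>M\<^esub>i\<in>{..<?n}. coset (g i))"
      using finsum_coset[of "{..<?n}" g] gR by simp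
    also have "\<dots> = (\<Oplus>\<^bsub>M\<^esub>i\<in>{..<?n}. restrict (\<lambda>i. coset (g i)) {..<?n} i)"
      using gR by (intro M.finsum_cong') (auto simp: carrier_M)
    finally show "\<exists>w. w \<in> (\<Pi>\<^sub>E i\<in>{..<?n}. coset ` supported (Ss ! i)) \<and> x = (\<Oplus>\<^bsub>M\<^esub>i\<in>{..<?n}. w i)"
      using gs by (intro exI[of _ "restrict (\<lambda>i. coset (g i)) {..<?n}"] conjI restrict_PiE_iff[THEN iffD2]) auto
  next
    have rep: "\<exists>f. (\<forall>i<?n. f i \<in> supported (Ss ! i) \<and> w i = coset (f i)) \<and> x = coset (\<Sum>i<?n. f i)"
      if w: "w \<in> (\<Pi>\<^sub>E i\<in>{..<?n}. coset ` supported (Ss ! i)) \<and> x = (\<Oplus>\<^bsub>M\<^esub>i\<in>{..<?n}. w i)" for w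
    proof -
      have "\<forall>i\<in>{..<?n}. \<exists>f. f \<in> supported (Ss ! i) \<and> w i = coset f"
        using w PiE_mem by blast
      then obtain f where f: "\<forall>i\<in>{..<?n}. f i \<in> supported (Ss ! i) \<and> w i = coset (f i)"
        using bchoice by metis
      then have fR: "f i \<in> carrier R" if "i < ?n" for i
        using that unfolding supported_def by simp
      have "x = (\<Oplus>\<^bsub>M\<^esub>i\<in>{..<?n}. coset (f i))"
        unfolding conjunct2[OF w] using f fR by (intro M.finsum_cong') (auto simp: carrier_M)
      also have "\<dots> = coset (\<Sum>i<?n. f i)"
        using fR by (intro finsum_coset) auto
      finally show ?thesis
        using f by auto
    qed
    fix w w' assume w: "w \<in> (\<Pi>\<^sub>E i\<in>{..<?n}. coset ` supported (Ss ! i)) \<and> x = (\<Oplus>\<^bsub>M\<^esub>i\<in>{..<?n}. w i)"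
      and w': "w' \<in> (\<Pi>\<^sub>E i\<in>{..<?n}. coset ` supported (Ss ! i)) \<and> x = (\<Oplus>\<^bsub>M\<^esub>i\<in>{..<?n}. w' i)"
    obtain f where f: "\<forall>i<?n. f i \<in> supported (Ss ! i) \<and> w i = coset (f i)" "x = coset (\<Sum>i<?n. f i)"
      using rep[OF w] by blast
    obtain g where g: "\<forall>i<?n. g i \<in> supported (Ss ! i) \<and> w' i = coset (g i)" "x = coset (\<Sum>i<?n. g i)"
      using rep[OF w'] by blast
    have "(\<Sum>i<?n. f i) \<in> carrier R" "(\<Sum>i<?n. g i) \<in> carrier R"
      using f(1) g(1) by (auto intro!: sum_closed simp: supported_def)
    then have diff: "(\<Sum>i<?n. f i) - (\<Sum>i<?n. g i) \<in> J"
      using f(2) g(2) coset_eq_iff[of "\<Sum>i<?n. f i" "\<Sum>i<?n. g i"] by simp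
    have "f i = g i" if i: "i < ?n" for i
    proof (rule poly_mapping_eqI)
      fix m
      show "Poly_Mapping.lookup (f i) m = Poly_Mapping.lookup (g i) m"
      proof (cases "m \<in> Ss ! i")
        case True
        then have "m \<notin> A"
          using cover i nth_mem by blast
        then have "Poly_Mapping.lookup ((\<Sum>i<?n. f i) - (\<Sum>i<?n. g i)) m = 0"
          using diff by (auto simp: in_J in_keys_iff)
        then show ?thesis
          using lookup_sum_parts[OF i True, of f] lookup_sum_parts[OF i True, of g] f(1) g(1)
          by (simp add: lookup_minus supported_def)
      next
        case False
        then have "m \<notin> Poly_Mapping.keys (f i)" "m \<notin> Poly_Mapping.keys (g i)"
          using f(1) g(1) i by (auto simp: supported_def)
        then show ?thesis
          by (simp add: in_keys_iff)
      qed
    qed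
    then have "w i = w' i" if "i \<in> {..<?n}" for i
      using f(1) g(1) that by simp
    then show "w = w'"
      using w w' by (intro PiE_ext[of w "{..<?n}" _ w']) auto
  qed
  moreover have "(\<Pi>\<^sub>E i\<in>{..<?n}. map (\<lambda>S. coset ` supported S) Ss ! i) = (\<Pi>\<^sub>E i\<in>{..<?n}. coset ` supported (Ss ! i))"
    by (intro PiE_cong) simp
  moreover have "coset ` supported S \<subseteq> carrier M" for S
    unfolding carrier_M supported_def by blast
  ultimately show ?thesis
    unfolding direct_sum_decomposition_def by auto
qed

definition monomial_cone :: "('v \<Rightarrow>\<^sub>0 nat) \<Rightarrow> 'v set \<Rightarrow> ('v \<Rightarrow>\<^sub>0 nat) set" where
  "monomial_cone c Z = {c + m | m. Poly_Mapping.keys m \<subseteq> Z}"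

lemma supported_add: "f \<in> supported S \<Longrightarrow> g \<in> supported S \<Longrightarrow> f + g \<in> supported S"
  using keys_add[of f g] by (auto simp: supported_def mpoly_ring_closed)

lemma submodule_supported: "submodule (coset ` supported S) (mpoly_ring {}) M"
proof (intro submodule.intro subgroup.intro submodule_axioms.intro)
  show "coset ` supported S \<subseteq> carrier (add_monoid M)"
    by (auto simp: carrier_M supported_def)
  show "x \<otimes>\<^bsub>add_monoid M\<^esub> y \<in> coset ` supported S" if xy: "x \<in> coset ` supported S" "y \<in> coset ` supported S" for x y
  proof -
    obtain f g where fg: "x = coset f" "y = coset g" "f \<in> supported S" "g \<in> supported S"
      using xy by blast
    then have "x \<otimes>\<^bsub>add_monoid M\<^esub> y = coset (f + g)"
      by (simp add: add_M supported_def)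
    then show ?thesis
      using supported_add fg by blast
  qed
  show "\<one>\<^bsub>add_monoid M\<^esub> \<in> coset ` supported S"
    by (auto simp: zero_M supported_def mpoly_ring_closed)
  show "inv\<^bsub>add_monoid M\<^esub> x \<in> coset ` supported S" if x: "x \<in> coset ` supported S" for x
  proof -
    obtain f where "x = coset f" "f \<in> supported S"
      using x by blast
    then have "inv\<^bsub>add_monoid M\<^esub> x = coset (- f)" "- f \<in> supported S"
      by (auto simp: a_inv_M supported_def mpoly_ring_closed in_keys_iff)
    then show ?thesis
      by blast
  qed
  show "a \<odot>\<^bsub>M\<^esub> x \<in> coset ` supported S" if a: "a \<in> carrier (mpoly_ring {})" and x: "x \<in> coset ` supported S" for a x
  proof -
    obtain f where f: "x = coset f" "f \<in> supported S"
      using x by blast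
    have aR: "a \<in> carrier R"
      using a by (auto simp: carrier_mpoly_ring)
    have "Poly_Mapping.keys (a * f) \<subseteq> S"
      using a f keys_mult[of a f] by (fastforce simp: carrier_mpoly_ring supported_def)
    then have "a * f \<in> supported S" "a \<odot>\<^bsub>M\<^esub> x = coset (a * f)"
      using f aR by (auto simp: supported_def mpoly_ring_closed smult_M)
    then show ?thesis
      by blast
  qed
qed

text \<open>The right side is a subspace containing the generators, so it contains the hull.
  Conversely, each of its elements is a finite sum of scalar multiples of generators, where a scalar
  \<open>k\<close> acts as the constant \<open>Poly_Mapping.single 0 k\<close>.\<close>

lemma stanley_space_eq:
  assumes c: "Poly_Mapping.keys c \<subseteq> V" and Z: "Z \<subseteq> V"
  shows "stanley_space M (coset (monom c)) Z = coset ` supported (monomial_cone c Z)"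
proof (rule antisym)
  have gen: "monom m \<odot>\<^bsub>M\<^esub> coset (monom c) = coset (monom (c + m))" if "Poly_Mapping.keys m \<subseteq> Z" for m
  proof -
    have "monom m \<in> carrier R" "monom c \<in> carrier R"
      using that c Z by (auto simp: monom_in_mpoly_ring)
    then show ?thesis
      by (simp add: smult_M monom_def mult_single add.commute)
  qed
  have monR: "monom (c + m) \<in> carrier R" if "Poly_Mapping.keys m \<subseteq> Z" for m
    using that c Z keys_add[of c m] by (auto simp: monom_in_mpoly_ring)
  show "stanley_space M (coset (monom c)) Z \<subseteq> coset ` supported (monomial_cone c Z)"
    unfolding stanley_space_def
  proof (intro hull_minimal submodule_supported subsetI)
    fix x assume "x \<in> {monom m \<odot>\<^bsub>M\<^esub> coset (monom c) |m. Poly_Mapping.keys m \<subseteq> Z}"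
    then obtain m where m: "Poly_Mapping.keys m \<subseteq> Z" "x = coset (monom (c + m))"
      using gen by auto
    then have "monom (c + m) \<in> supported (monomial_cone c Z)"
      using monR by (auto simp: supported_def monomial_cone_def monom_def)
    then show "x \<in> coset ` supported (monomial_cone c Z)"
      using m(2) by blast
  qed
  show "coset ` supported (monomial_cone c Z) \<subseteq> stanley_space M (coset (monom c)) Z"
    unfolding stanley_space_def hull_def
  proof (intro Inter_greatest)
    fix W assume "W \<in> {t. submodule t (mpoly_ring {}) M \<and>
        {monom m \<odot>\<^bsub>M\<^esub> coset (monom c) |m. Poly_Mapping.keys m \<subseteq> Z} \<subseteq> t}"
    then have sub: "submodule W (mpoly_ring {}) M"
      and W: "\<And>m. Poly_Mapping.keys m \<subseteq> Z \<Longrightarrow> monom m \<odot>\<^bsub>M\<^esub> coset (monom c) \<in> W"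
      by blast+
    interpret W: submodule W "mpoly_ring {}" M
      by (rule sub)
    have single: "coset (Poly_Mapping.single x k) \<in> W" if x: "x \<in> monomial_cone c Z" for x k
    proof -
      obtain m where m: "x = c + m" "Poly_Mapping.keys m \<subseteq> Z"
        using x by (auto simp: monomial_cone_def)
      have k: "Poly_Mapping.single 0 k \<in> carrier (mpoly_ring Y)" for Y :: "'v set"
        by (simp add: carrier_mpoly_ring)
      have "Poly_Mapping.single 0 k \<odot>\<^bsub>M\<^esub> coset (monom x) \<in> W"
        using W.smult_closed[OF k W[OF m(2)]] gen[OF m(2)] m(1) by simp
      moreover have "Poly_Mapping.single 0 k \<odot>\<^bsub>M\<^esub> coset (monom x) = coset (Poly_Mapping.single x k)"
        using monR[OF m(2)] k m(1) by (subst smult_M) (auto simp: monom_def mult_single)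
      ultimately show ?thesis
        by simp
    qed
    show "coset ` supported (monomial_cone c Z) \<subseteq> W"
    proof
      fix y assume "y \<in> coset ` supported (monomial_cone c Z)"
      then obtain f where f: "y = coset f" "f \<in> supported (monomial_cone c Z)"
        by blast
      have fR: "f \<in> carrier R" and keysf: "Poly_Mapping.keys f \<subseteq> monomial_cone c Z"
        using f(2) by (auto simp: supported_def)
      have "S \<subseteq> Poly_Mapping.keys f \<Longrightarrow> coset (\<Sum>m\<in>S. Poly_Mapping.single m (Poly_Mapping.lookup f m)) \<in> W"
        if "finite S" for S
        using that
      proof (induction S rule: finite_induct)
        case empty
        then show ?case
          using W.one_closed zero_M by simp
      next
        case (insert x S)
        let ?g = "\<lambda>m. Poly_Mapping.single m (Poly_Mapping.lookup f m)"
        have gR: "?g m \<in> carrier R" if "m \<in> insert x S" for m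
          using that insert.prems fR by (auto simp: carrier_mpoly_ring split: if_splits)
        then have "(\<Sum>m\<in>S. ?g m) \<in> carrier R"
          using insert.hyps(1) by (intro sum_closed) auto
        then have "coset (\<Sum>m\<in>insert x S. ?g m) = coset (?g x) \<oplus>\<^bsub>M\<^esub> coset (\<Sum>m\<in>S. ?g m)"
          using insert.hyps gR by (simp add: add_M)
        moreover have "coset (?g x) \<in> W" "coset (\<Sum>m\<in>S. ?g m) \<in> W"
          using single insert keysf by auto
        ultimately show ?case
          using W.m_closed by simp
      qed
      then show "y \<in> W"
        using f(1) poly_mapping_sum_single[of f] by (metis finite_keys order_refl)
    qed
  qed
qed

text \<open>The coefficient of \<open>f * monom c\<close> at \<open>c + m\<close> is that of
  \<open>f\<close> at \<open>m\<close>. These monomials lie outside \<open>A\<close>, so no nonzero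
  \<open>f\<close> can bring the product into \<open>J\<close>.\<close>

lemma free_generator_monom:
  assumes "Poly_Mapping.keys c \<subseteq> V" "Z \<subseteq> V" "monomial_cone c Z \<inter> A = {}"
  shows "free_generator M (coset (monom c)) Z"
  unfolding free_generator_def
proof (intro ballI impI)
  fix f assume f: "f \<in> carrier (mpoly_ring Z)" "f \<odot>\<^bsub>M\<^esub> coset (monom c) = \<zero>\<^bsub>M\<^esub>"
  have fR: "f \<in> carrier R"
    using f(1) assms(2) by (auto simp: carrier_mpoly_ring)
  have cR: "monom c \<in> carrier R"
    using assms(1) by (simp add: monom_in_mpoly_ring)
  have "coset (f * monom c) = coset 0"
    using f(2) smult_M[OF fR cR] zero_M by simp
  then have J: "f * monom c \<in> J"
    using coset_eq_iff[OF mpoly_ring_closed(2)[OF fR cR] mpoly_ring_closed(4)] by simp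
  show "f = 0"
  proof (rule ccontr)
    assume "f \<noteq> 0"
    then obtain m where m: "m \<in> Poly_Mapping.keys f"
      using poly_mapping_eqI[of f 0] by (auto simp: in_keys_iff)
    have "f * monom c = (\<Sum>x\<in>Poly_Mapping.keys f. Poly_Mapping.single (x + c) (Poly_Mapping.lookup f x))"
      unfolding monom_def by (subst poly_mapping_sum_single[of f]) (simp add: sum_distrib_right mult_single)
    then have "Poly_Mapping.lookup (f * monom c) (c + m) =
        (\<Sum>x\<in>Poly_Mapping.keys f. if x = m then Poly_Mapping.lookup f x else 0)"
      by (auto simp: lookup_sum lookup_single when_def add.commute[of c] intro!: sum.cong)
    then have "c + m \<in> Poly_Mapping.keys (f * monom c)"
      using m by (simp add: in_keys_iff)
    moreover have "c + m \<in> monomial_cone c Z"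
      using m f(1) by (auto simp: monomial_cone_def carrier_mpoly_ring)
    ultimately show False
      using J assms(3) by (auto simp: in_J)
  qed
qed

text \<open>\<open>Min\<close> and \<open>Max\<close> are meaningful only on finite nonempty sets.
  As \<open>0 \<notin> A\<close>, the quotient is nonzero and every Stanley decomposition has a
  summand; each depth is then at most \<open>card V\<close>, which makes the set of depths
  finite.\<close>

lemma sdepth_quotient_ge:
  assumes "finite V" "0 \<notin> A" "distinct D"
    and D: "\<And>p. p \<in> set D \<Longrightarrow> Poly_Mapping.keys (fst p) \<subseteq> V \<and> snd p \<subseteq> V \<and> b \<le> card (snd p)"
    and disj: "\<And>p q. p \<in> set D \<Longrightarrow> q \<in> set D \<Longrightarrow> p \<noteq> q \<Longrightarrow>
      monomial_cone (fst p) (snd p) \<inter> monomial_cone (fst q) (snd q) = {}"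
    and cover: "(\<Union>p\<in>set D. monomial_cone (fst p) (snd p)) = {m. Poly_Mapping.keys m \<subseteq> V \<and> m \<notin> A}"
  shows "b \<le> sdepth_quotient V J"
proof -
  let ?D = "map (\<lambda>p. (coset (monom (fst p)), snd p)) D"
  have nonempty: "D' \<noteq> []" if "stanley_decomposition V M (quotient_component V J) D'" for D'
  proof
    assume "D' = []"
    then have "direct_sum_decomposition M []"
      using that by (simp add: stanley_decomposition_def)
    moreover have "coset 1 \<in> carrier M"
      by (auto simp: carrier_M mpoly_ring_closed)
    ultimately have "coset 1 = (\<Oplus>\<^bsub>M\<^esub>i\<in>{..<0::nat}. undefined i)"
      unfolding direct_sum_decomposition_def by auto
    then have "coset 1 = coset 0"
      by (simp add: zero_M)
    then have "(1 :: ('v, 'k) mpoly) \<in> J"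
      using coset_eq_iff[of 1 0] by (simp add: mpoly_ring_closed)
    then show False
      using assms(2) by (simp add: in_J)
  qed
  have fin: "finite {card Z |u Z. (u, Z) \<in> set D'}" for D' :: "(('v, 'k) mpoly set \<times> 'v set) list"
  proof -
    have "{card Z |u Z. (u, Z) \<in> set D'} = (\<lambda>p. card (snd p)) ` set D'"
      by force
    then show ?thesis
      by simp
  qed
  have dec: "stanley_decomposition V M (quotient_component V J) ?D"
    unfolding stanley_decomposition_def
  proof
    have "(\<exists>a. coset (monom (fst p)) \<in> quotient_component V J a) \<and> snd p \<subseteq> V \<and>
        free_generator M (coset (monom (fst p))) (snd p)" if p: "p \<in> set D" for p
    proof (intro conjI)
      have "monom (fst p) \<in> mpoly_component V (\<lambda>v. int (Poly_Mapping.lookup (fst p) v))"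
        using D[OF p] by (simp add: mpoly_component_def carrier_mpoly_ring monom_def)
      then show "\<exists>a. coset (monom (fst p)) \<in> quotient_component V J a"
        unfolding quotient_component_def coset_def by blast
      show "free_generator M (coset (monom (fst p))) (snd p)"
        using D[OF p] cover p by (intro free_generator_monom) auto
    qed (use D p in auto)
    then show "\<forall>(u, Z)\<in>set ?D. (\<exists>a. u \<in> quotient_component V J a) \<and> Z \<subseteq> V \<and> free_generator M u Z"
      by auto
    have "map (\<lambda>(u, Z). stanley_space M u Z) ?D =
        map (\<lambda>S. coset ` supported S) (map (\<lambda>p. monomial_cone (fst p) (snd p)) D)"
      unfolding map_map
    proof (rule map_cong[OF HOL.refl])
      fix p assume "p \<in> set D"
      then show "((\<lambda>(u, Z). stanley_space M u Z) \<circ> (\<lambda>p. (coset (monom (fst p)), snd p))) p =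
          ((\<lambda>S. coset ` supported S) \<circ> (\<lambda>p. monomial_cone (fst p) (snd p))) p"
        using D[of p] stanley_space_eq[of "fst p" "snd p"] by simp
    qed
    moreover have "direct_sum_decomposition M \<dots>"
    proof (rule direct_sum_supported)
      fix i j assume "i < length (map (\<lambda>p. monomial_cone (fst p) (snd p)) D)"
        "j < length (map (\<lambda>p. monomial_cone (fst p) (snd p)) D)" "i \<noteq> j"
      then show "map (\<lambda>p. monomial_cone (fst p) (snd p)) D ! i \<inter> map (\<lambda>p. monomial_cone (fst p) (snd p)) D ! j = {}"
        using disj[of "D ! i" "D ! j"] \<open>distinct D\<close> by (simp add: nth_eq_iff_index_eq)
    qed (use cover in auto)
    ultimately show "direct_sum_decomposition M (map (\<lambda>(u, Z). stanley_space M u Z) ?D)"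
      by (simp only:)
  qed
  have "b \<le> sdepth_decomposition ?D"
    unfolding sdepth_decomposition_def
  proof (rule Min.boundedI)
    show "{card Z |u Z. (u, Z) \<in> set ?D} \<noteq> {}"
      using nonempty[OF dec] by (cases D) auto
    show "finite {card Z |u Z. (u, Z) \<in> set ?D}"
      by (rule fin)
  qed (use D in auto)
  also have "\<dots> \<le> sdepth V M (quotient_component V J)"
    unfolding sdepth_def
  proof (rule Max_ge)
    have "sdepth_decomposition D' \<le> card V" if D': "stanley_decomposition V M (quotient_component V J) D'" for D'
    proof -
      obtain u Z where uZ: "(u, Z) \<in> set D'"
        using nonempty[OF D'] by (cases D') auto
      then have "sdepth_decomposition D' \<le> card Z"
        unfolding sdepth_decomposition_def using fin by (intro Min_le) blast+
      also have "card Z \<le> card V"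
        using D' uZ assms(1) unfolding stanley_decomposition_def by (intro card_mono) auto
      finally show ?thesis .
    qed
    then have "{sdepth_decomposition D' |D'. stanley_decomposition V M (quotient_component V J) D'} \<subseteq> {..card V}"
      by blast
    then show "finite {sdepth_decomposition D' |D'. stanley_decomposition V M (quotient_component V J) D'}"
      by (rule finite_subset) simp
    show "sdepth_decomposition ?D \<in> {sdepth_decomposition D' |D'. stanley_decomposition V M (quotient_component V J) D'}"
      by (rule CollectI, rule exI[of _ ?D], rule conjI[OF HOL.refl dec])
  qed
  finally show ?thesis
    by (simp add: sdepth_quotient_def)
qed

end

section \<open>Powers of edge ideals\<close>

definition mset_of :: "('v \<Rightarrow>\<^sub>0 nat) \<Rightarrow> 'v multiset" where
  "mset_of m = (\<Sum>x\<in>Poly_Mapping.keys m. replicate_mset (Poly_Mapping.lookup m x) x)"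

lemma count_mset_of [simp]: "count (mset_of m) = Poly_Mapping.lookup m"
proof
  fix v
  have "count (mset_of m) v = (\<Sum>x\<in>Poly_Mapping.keys m. if x = v then Poly_Mapping.lookup m x else 0)"
    unfolding mset_of_def count_sum by (intro sum.cong) auto
  then show "count (mset_of m) v = Poly_Mapping.lookup m v"
    by (simp add: in_keys_iff)
qed

lemma set_mset_of [simp]: "set_mset (mset_of m) = Poly_Mapping.keys m"
  by (simp add: set_mset_def keys.rep_eq)

lemma mset_of_add: "mset_of (m + n) = mset_of m + mset_of n"
  by (simp add: multiset_eq_iff lookup_add)

lemma mset_of_0 [simp]: "mset_of 0 = {#}"
  by (simp add: multiset_eq_iff)

lemma mset_of_inject: "mset_of m = mset_of n \<longleftrightarrow> m = n"
  by (metis count_mset_of poly_mapping_eqI)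

lemma mset_of_surj: "\<exists>m. mset_of m = M"
proof -
  have "Poly_Mapping.lookup (Abs_poly_mapping (count M)) = count M"
    by (simp flip: set_mset_def)
  then show ?thesis
    by (metis count_mset_of count_inject)
qed

definition edge_monomials :: "'v set set \<Rightarrow> nat \<Rightarrow> ('v \<Rightarrow>\<^sub>0 nat) set" where
  "edge_monomials E t = {m. divisible_by_edges E t (mset_of m)}"

text \<open>A polynomial is the sum of its terms; this reduces the inclusion of a monomial ideal in
  another ideal to single terms.\<close>

lemma single_ideal_sum:
  assumes "ideal I (mpoly_ring V)"
    and "\<And>m k. m \<in> Poly_Mapping.keys f \<Longrightarrow> Poly_Mapping.single m k \<in> (I :: ('v, 'k::field) mpoly set)"
  shows "f \<in> I"
proof -
  note I = ideal.axioms(1)[OF assms(1)]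
  have "(\<Sum>m\<in>S. Poly_Mapping.single m (Poly_Mapping.lookup f m)) \<in> I" if "finite S" "S \<subseteq> Poly_Mapping.keys f" for S
    using that
  proof (induction S rule: finite_induct)
    case empty
    then show ?case
      using additive_subgroup.zero_closed[OF I] by simp
  next
    case (insert x S)
    then show ?case
      using additive_subgroup.a_closed[OF I, of "Poly_Mapping.single x (Poly_Mapping.lookup f x)" "\<Sum>m\<in>S. Poly_Mapping.single m (Poly_Mapping.lookup f m)"] assms(2)
      by simp
  qed
  from this[of "Poly_Mapping.keys f"] show ?thesis
    using poly_mapping_sum_single[of f] by simp
qed

context finite_simple_graph
begin

lemma edge_monomials_up: "a \<in> edge_monomials E t \<Longrightarrow> m + a \<in> edge_monomials E t"
  unfolding edge_monomials_def by (auto simp: mset_of_add elim: divisible_by_edges_mono)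

lemma monomial_ideal_is_ideal: "ideal (monomial_ideal V (edge_monomials E t) :: ('v, 'k::field) mpoly set) (mpoly_ring V)"
proof -
  interpret monomial_quotient V "edge_monomials E t" "monomial_ideal V (edge_monomials E t) :: ('v, 'k) mpoly set"
    by unfold_locales (auto intro: edge_monomials_up)
  show ?thesis
    by (rule J.is_ideal)
qed

lemma edge_monomials_Suc:
  "m \<in> edge_monomials E (Suc t) \<longleftrightarrow> (\<exists>a\<in>edge_monomials E t. \<exists>b\<in>edge_monomials E 1. m = a + b)"
proof
  assume "m \<in> edge_monomials E (Suc t)"
  then obtain F where F: "set_mset F \<subseteq> E" "size F = Suc t" "edge_product F \<subseteq># mset_of m"
    by (auto simp: edge_monomials_def divisible_by_edges_def)
  then obtain e F' where e: "F = add_mset e F'" "size F' = t"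
    by (metis size_eq_Suc_imp_eq_union size_add_mset nat.inject)
  then obtain N where N: "mset_of m = mset_set e + edge_product F' + N"
    using F(3) by (metis edge_product_simps(2) subset_mset.le_iff_add)
  obtain a b where ab: "mset_of a = edge_product F' + N" "mset_of b = mset_set e"
    using mset_of_surj by metis
  have "mset_of m = mset_of (a + b)"
    by (simp add: mset_of_add ab N ac_simps)
  then have "m = a + b"
    by (simp add: mset_of_inject)
  moreover have "a \<in> edge_monomials E t"
    unfolding edge_monomials_def divisible_by_edges_def using ab e F(1) by auto
  moreover have "b \<in> edge_monomials E 1"
    unfolding edge_monomials_def divisible_by_edges_def using ab e F(1)
    by (auto intro!: exI[of _ "{#e#}"])
  ultimately show "\<exists>a\<in>edge_monomials E t. \<exists>b\<in>edge_monomials E 1. m = a + b"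
    by blast
next
  assume "\<exists>a\<in>edge_monomials E t. \<exists>b\<in>edge_monomials E 1. m = a + b"
  then obtain a b F G where "m = a + b"
    "set_mset F \<subseteq> E" "size F = t" "edge_product F \<subseteq># mset_of a"
    "set_mset G \<subseteq> E" "size G = 1" "edge_product G \<subseteq># mset_of b"
    unfolding edge_monomials_def divisible_by_edges_def by blast
  then show "m \<in> edge_monomials E (Suc t)"
    unfolding edge_monomials_def divisible_by_edges_def
    by (auto simp: mset_of_add intro!: exI[of _ "F + G"] subset_mset.add_mono)
qed

lemma edge_ideal_eq: "edge_ideal V E = (monomial_ideal V (edge_monomials E 1) :: ('v, 'k::field) mpoly set)"
proof -
  let ?R = "mpoly_ring V :: ('v, 'k) mpoly ring"
  let ?G = "{var x * var y | x y. {x, y} \<in> E} :: ('v, 'k) mpoly set"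
  interpret R: cring ?R
    by (rule mpoly_ring_cring)
  have edge: "var x * var y = (monom m :: ('v, 'k) mpoly)" if "mset_of m = {#x, y#}" for x y m
  proof -
    have "mset_of (Poly_Mapping.single x 1 + Poly_Mapping.single y (1::nat)) = {#x, y#}"
      by (simp add: multiset_eq_iff lookup_add lookup_single when_def)
    then have "m = Poly_Mapping.single x 1 + Poly_Mapping.single y 1"
      using that mset_of_inject by metis
    then show ?thesis
      by (simp add: var_def monom_def mult_single)
  qed
  have Gin: "?G \<subseteq> monomial_ideal V (edge_monomials E 1)"
  proof
    fix g assume "g \<in> ?G"
    then obtain x y where xy: "g = var x * var y" "{x, y} \<in> E"
      by blast
    obtain m where m: "mset_of m = {#x, y#}"
      using mset_of_surj by metis
    have "Poly_Mapping.keys m = {x, y}"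
      using m set_mset_of[of m] by simp
    moreover have "m \<in> edge_monomials E 1"
      unfolding edge_monomials_def divisible_by_edges_def using m xy(2) mset_edge
      by (auto intro!: exI[of _ "{#{x, y}#}"])
    ultimately show "g \<in> monomial_ideal V (edge_monomials E 1)"
      using edgeD[OF xy(2)] edge[OF m] xy(1)
      by (simp add: monomial_ideal_def carrier_mpoly_ring monom_def)
  qed
  then have "?G \<subseteq> carrier ?R"
    by (auto simp: monomial_ideal_def)
  then have idl: "ideal (Idl\<^bsub>?R\<^esub> ?G) ?R" and sub: "?G \<subseteq> Idl\<^bsub>?R\<^esub> ?G"
    using R.genideal_ideal R.genideal_self by blast+
  show ?thesis
    unfolding edge_ideal_def
  proof (rule antisym)
    show "Idl\<^bsub>?R\<^esub> ?G \<subseteq> monomial_ideal V (edge_monomials E 1)"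
      by (rule R.genideal_minimal[OF monomial_ideal_is_ideal Gin])
    show "monomial_ideal V (edge_monomials E 1) \<subseteq> Idl\<^bsub>?R\<^esub> ?G"
    proof
      fix f :: "('v, 'k) mpoly" assume f: "f \<in> monomial_ideal V (edge_monomials E 1)"
      show "f \<in> Idl\<^bsub>?R\<^esub> ?G"
      proof (rule single_ideal_sum[OF idl])
        fix m and k :: 'k assume m: "m \<in> Poly_Mapping.keys f"
        then have mV: "Poly_Mapping.keys m \<subseteq> V"
          using f by (auto simp: monomial_ideal_def carrier_mpoly_ring)
        obtain F where F: "set_mset F \<subseteq> E" "size F = 1" "edge_product F \<subseteq># mset_of m"
          using m f by (auto simp: monomial_ideal_def edge_monomials_def divisible_by_edges_def)
        then obtain e where e: "F = {#e#}" "e \<in> E"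
          using size_1_singleton_mset[of F] by auto
        then obtain x y where xy: "e = {x, y}" "x \<noteq> y"
          using edgeE by metis
        obtain N where N: "mset_of m = {#x, y#} + N"
          using F(3) e xy by (auto simp: subset_mset.le_iff_add)
        obtain a b where ab: "mset_of a = {#x, y#}" "mset_of b = N"
          using mset_of_surj by metis
        have "mset_of m = mset_of (b + a)"
          by (simp add: mset_of_add ab N)
        then have "m = b + a"
          by (simp add: mset_of_inject)
        then have "Poly_Mapping.single m k = Poly_Mapping.single b k * (var x * var y)"
          by (simp add: edge[OF ab(1)] monom_def mult_single)
        moreover have "var x * var y \<in> Idl\<^bsub>?R\<^esub> ?G"
          using sub e(2) xy(1) by blast
        moreover have "Poly_Mapping.keys b \<subseteq> V"
          using mV N ab(2) set_mset_of[of m] set_mset_of[of b] by auto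
        then have "Poly_Mapping.single b k \<in> carrier ?R"
          by (simp add: carrier_mpoly_ring)
        ultimately show "Poly_Mapping.single m k \<in> Idl\<^bsub>?R\<^esub> ?G"
          using ideal.I_l_closed[OF idl, of "var x * var y" "Poly_Mapping.single b k"] by simp
      qed
    qed
  qed
qed

text \<open>The zeroth power is the whole ring, matching the empty product of edges, which divides
  everything. In the step, \<open>edge_monomials_Suc\<close> adds the exponents of a product for one
  inclusion and splits one edge off each term for the other.\<close>

lemma edge_ideal_power:
  "edge_ideal V E [^]\<^bsub>ideals_set (mpoly_ring V)\<^esub> t = (monomial_ideal V (edge_monomials E t) :: ('v, 'k::field) mpoly set)"
proof (induction t)
  case 0
  have "edge_monomials E 0 = UNIV"
    by (auto simp: edge_monomials_def divisible_by_edges_def)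
  then show ?case
    by (simp add: monomial_ideal_def nat_pow_def ideals_set_def)
next
  case (Suc t)
  let ?R = "mpoly_ring V :: ('v, 'k) mpoly ring"
  let ?I = "\<lambda>t. monomial_ideal V (edge_monomials E t) :: ('v, 'k) mpoly set"
  interpret R: cring ?R
    by (rule mpoly_ring_cring)
  have "edge_ideal V E [^]\<^bsub>ideals_set ?R\<^esub> Suc t = ideal_prod ?R (?I t) (?I 1)"
    using Suc by (simp add: nat_pow_def ideals_set_def edge_ideal_eq)
  also have "\<dots> = ?I (Suc t)"
  proof (rule antisym)
    show "ideal_prod ?R (?I t) (?I 1) \<subseteq> ?I (Suc t)"
    proof
      fix f assume "f \<in> ideal_prod ?R (?I t) (?I 1)"
      then show "f \<in> ?I (Suc t)"
      proof (induction rule: ideal_prod.induct)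
        case (prod i j)
        then have "Poly_Mapping.keys (i * j) \<subseteq> edge_monomials E (Suc t)"
          using keys_mult[of i j] edge_monomials_Suc unfolding monomial_ideal_def by blast
        then show ?case
          using prod by (simp add: monomial_ideal_def mpoly_ring_closed)
      next
        case (sum s1 s2)
        then show ?case
          using keys_add[of s1 s2] by (auto simp: monomial_ideal_def mpoly_ring_closed)
      qed
    qed
    have idl: "ideal (ideal_prod ?R (?I t) (?I 1)) ?R"
      by (rule R.ideal_prod_is_ideal) (rule monomial_ideal_is_ideal)+
    show "?I (Suc t) \<subseteq> ideal_prod ?R (?I t) (?I 1)"
    proof
      fix f assume f: "f \<in> ?I (Suc t)"
      show "f \<in> ideal_prod ?R (?I t) (?I 1)"
      proof (rule single_ideal_sum[OF idl])
        fix m and k :: 'k assume m: "m \<in> Poly_Mapping.keys f"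
        then have "m \<in> edge_monomials E (Suc t)" and mV: "Poly_Mapping.keys m \<subseteq> V"
          using f by (auto simp: monomial_ideal_def carrier_mpoly_ring)
        then obtain a b where ab: "a \<in> edge_monomials E t" "b \<in> edge_monomials E 1" "m = a + b"
          using edge_monomials_Suc by blast
        have "Poly_Mapping.keys m = Poly_Mapping.keys a \<union> Poly_Mapping.keys b"
          unfolding ab(3) using set_mset_of[of "a + b"] by (simp add: mset_of_add)
        then have "Poly_Mapping.single a k \<in> ?I t" "Poly_Mapping.single b 1 \<in> ?I 1"
          using ab mV by (auto simp: monomial_ideal_def carrier_mpoly_ring)
        then have "Poly_Mapping.single a k \<otimes>\<^bsub>?R\<^esub> Poly_Mapping.single b 1 \<in> ideal_prod ?R (?I t) (?I 1)"
          by (rule ideal_prod.prod)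
        then show "Poly_Mapping.single m k \<in> ideal_prod ?R (?I t) (?I 1)"
          using ab(3) by (simp add: mult_single)
      qed
    qed
  qed
  finally show ?case .
qed

lemma sdepth_power_ge:
  assumes "V \<noteq> {}" "1 \<le> t" "t \<le> 3"
    and b: "int b \<le> \<lceil>(real (diameter V E) - 4 * real t + 5) / 3\<rceil> + int (card (components V E)) - 1"
  shows "b \<le> sdepth_quotient V (monomial_ideal V (edge_monomials E t) :: ('v, 'k::field) mpoly set)"
proof -
  interpret monomial_quotient V "edge_monomials E t" "monomial_ideal V (edge_monomials E t) :: ('v, 'k) mpoly set"
    by unfold_locales (auto intro: edge_monomials_up)
  \<comment> \<open>At the start nothing has been divided off: no factors, no excluded edges, no
    forbidden variables.\<close>
  have "cone_partition V b {m. set_mset m \<subseteq> V \<and> \<not> divisible_by_edges E t m}"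
    using not_divisible_cone_partition[OF assms(1,3) b, of "{#}" "{}" "{}"] by simp
  from cone_partition_list[OF this] obtain D where D: "\<forall>p \<in> set D. set_mset (fst p) \<subseteq> V \<and> snd p \<subseteq> V \<and> b \<le> card (snd p)"
    and dist: "distinct D"
    and disj: "pairwise (\<lambda>p q. disjnt (cone (fst p) (snd p)) (cone (fst q) (snd q))) (set D)"
    and cover: "(\<Union>p\<in>set D. cone (fst p) (snd p)) = {m. set_mset m \<subseteq> V \<and> \<not> divisible_by_edges E t m}"
    by (elim exE conjE)
  define r :: "'v multiset \<Rightarrow> 'v \<Rightarrow>\<^sub>0 nat" where "r = inv_into UNIV mset_of"
  have r: "mset_of (r M) = M" for M :: "'v multiset"
    unfolding r_def using mset_of_surj[of M] by (intro f_inv_into_f) blast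
  have keys_r: "Poly_Mapping.keys (r M) = set_mset M" for M :: "'v multiset"
    by (simp flip: set_mset_of add: r)
  have cone_iff: "m \<in> monomial_cone (r c) Z \<longleftrightarrow> mset_of m \<in> cone c Z" for m c Z
  proof
    assume "m \<in> monomial_cone (r c) Z"
    then obtain n where n: "m = r c + n" "Poly_Mapping.keys n \<subseteq> Z"
      by (auto simp: monomial_cone_def)
    then have "mset_of m = c + mset_of n" "set_mset (mset_of n) \<subseteq> Z"
      by (simp_all add: mset_of_add r)
    then show "mset_of m \<in> cone c Z"
      unfolding cone_def by blast
  next
    assume "mset_of m \<in> cone c Z"
    then obtain N where N: "mset_of m = c + N" "set_mset N \<subseteq> Z"
      by (auto simp: cone_def)
    then have "mset_of m = mset_of (r c + r N)"
      by (simp add: mset_of_add r)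
    then have "m = r c + r N" "Poly_Mapping.keys (r N) \<subseteq> Z"
      using N(2) by (simp_all add: mset_of_inject keys_r)
    then show "m \<in> monomial_cone (r c) Z"
      by (auto simp: monomial_cone_def)
  qed
  show ?thesis
  proof (rule sdepth_quotient_ge[of "map (\<lambda>p. (r (fst p), snd p)) D"])
    show "0 \<notin> edge_monomials E t"
    proof
      assume "0 \<in> edge_monomials E t"
      then obtain F where "set_mset F \<subseteq> E" "size F = t" "edge_product F = {#}"
        by (auto simp: edge_monomials_def divisible_by_edges_def)
      then show False
        using size_edge_product[of F] assms(2) by simp
    qed
    have "inj_on (\<lambda>p. (r (fst p), snd p)) (set D)"
      using r by (intro inj_onI) (metis prod.collapse prod.inject)
    then show "distinct (map (\<lambda>p. (r (fst p), snd p)) D)"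
      using dist by (simp add: distinct_map)
    show "Poly_Mapping.keys (fst p) \<subseteq> V \<and> snd p \<subseteq> V \<and> b \<le> card (snd p)"
      if p: "p \<in> set (map (\<lambda>p. (r (fst p), snd p)) D)" for p
    proof -
      obtain q where "q \<in> set D" "p = (r (fst q), snd q)"
        using p by auto
      then show ?thesis
        using D keys_r by simp
    qed
    show "monomial_cone (fst p) (snd p) \<inter> monomial_cone (fst q) (snd q) = {}"
      if p: "p \<in> set (map (\<lambda>p. (r (fst p), snd p)) D)" and q: "q \<in> set (map (\<lambda>p. (r (fst p), snd p)) D)" and "p \<noteq> q" for p q
    proof -
      obtain p' q' where pq: "p' \<in> set D" "p = (r (fst p'), snd p')" "q' \<in> set D" "q = (r (fst q'), snd q')"
        using p q by auto
      then have "p' \<noteq> q'"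
        using \<open>p \<noteq> q\<close> by blast
      then have "disjnt (cone (fst p') (snd p')) (cone (fst q') (snd q'))"
        using disj pq by (auto simp: pairwise_def)
      then show ?thesis
        using pq cone_iff by (auto simp: disjnt_def)
    qed
    have "m \<in> (\<Union>p\<in>set (map (\<lambda>p. (r (fst p), snd p)) D). monomial_cone (fst p) (snd p)) \<longleftrightarrow>
        mset_of m \<in> (\<Union>p\<in>set D. cone (fst p) (snd p))" for m
      using cone_iff by simp
    then show "(\<Union>p\<in>set (map (\<lambda>p. (r (fst p), snd p)) D). monomial_cone (fst p) (snd p)) =
        {m. Poly_Mapping.keys m \<subseteq> V \<and> m \<notin> edge_monomials E t}"
      unfolding cover by (auto simp: edge_monomials_def)
  qed (rule finite_V)
qed

end

theorem theorem4p18: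
  fixes V :: "'v set" and E :: "'v set set"
    and R :: "('v, 'k::field) mpoly ring" and I :: "('v, 'k) mpoly set"
    and d p t :: nat
  assumes "simple_graph V E"
    and "no_isolated_vertices V E"
    and "V \<noteq> {}"
    and "p = card (components V E)"
    and "R = mpoly_ring V"
    and "I = edge_ideal V E"
    and "d = diameter V E"
    and "1 \<le> t" and "t \<le> 3"
  shows "int (sdepth_quotient V (I [^]\<^bsub>ideals_set R\<^esub> t))
           \<ge> \<lceil>(real d - 4 * real t + 5) / 3\<rceil> + int p - 1"
proof -
  interpret finite_simple_graph V E
    by unfold_locales (rule assms(1))
  let ?b = "\<lceil>(real d - 4 * real t + 5) / 3\<rceil> + int p - 1"
  show ?thesis
  \<comment> \<open>The bound can be negative for small \<open>d\<close>; then it holds because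
    Stanley depth is a natural number. Otherwise \<open>nat ?b\<close> loses nothing.\<close>
  proof (cases "0 \<le> ?b")
    case True
    then have "nat ?b \<le> sdepth_quotient V (monomial_ideal V (edge_monomials E t) :: ('v, 'k) mpoly set)"
      using assms(3,4,7,8,9) by (intro sdepth_power_ge) auto
    then show ?thesis
      using assms(5,6) edge_ideal_power[where t = t and 'k = 'k] by (simp add: nat_le_iff)
  qed simp
qed

end
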